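(* For every integer $t>2$, $$\delta_{t,2}(G_{\infty}) = \frac{1}{2(t-1)^2}.$$
   Context: $G_\infty$ denotes the infinite grid: the graph with vertex set $\mathbb{Z}\times\mathbb{Z}$ in which two vertices are adjacent if and only if they are at Euclidean distance $1$. $dist(\cdot,\cdot)$ is the graph distance (so $dist((a,b),(c,d))=|a-c|+|b-d|$). Let $t,r$ be positive integers. For a set of vertices $\mathbb{T}\subseteq \mathbb{Z}\times\mathbb{Z}$ (whose elements are called towers, of signal strength $t$), the signal a vertex $v$ receives from a tower $T\in\mathbb{T}$ is $sig(v,T)=\min(\max(t-dist(v,T),0),r)$, and the total signal at $v$ is $sig(v)=\sum_{T\in\mathbb{T}} sig(v,T)$. The set $\mathbb{T}$ is a $(t,r)$ broadcast on $G_\infty$ if $sig(v)\geq r$ for every vertex $v$. (Omitting the truncation at $r$ in the definition of signal gives the same notion of broadcast.) The broadcast density of $\mathbb{T}$ is $\lim_{n\to\infty} \frac{|\mathbb{T}\cap V_n|}{|V_n|}$, where $V_n=\{-n,\dots,n\}\times\{-n,\dots,n\}$. The optimal density $\delta_{t,r}(G_\infty)$ is the minimum broadcast density over all $(t,r)$ broadcasts on $G_\infty$ (among those for which the limit exists). *)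

theory Defs
  imports "HOL-Analysis.Analysis"
begin

type_synonym vertex = "int \<times> int"

text \<open>The metric on the product type \<open>real \<times> real\<close> is the Euclidean one.\<close>

definition grid_adj :: "(vertex \<times> vertex) set" where
  "grid_adj = {((a, b), (c, d)).
     dist (real_of_int a, real_of_int b) (real_of_int c, real_of_int d) = 1}"

text \<open>A pair in the \<open>n\<close>-fold relational power is joined by a walk of length \<open>n\<close>.\<close>

definition grid_dist :: "vertex \<Rightarrow> vertex \<Rightarrow> nat" where
  "grid_dist u v = (LEAST n. (u, v) \<in> grid_adj ^^ n)"

definition tower_signal :: "nat \<Rightarrow> nat \<Rightarrow> vertex \<Rightarrow> vertex \<Rightarrow> int" where
  "tower_signal t r v T = min (max (int t - int (grid_dist v T)) 0) (int r)"

text \<open>The set of towers may be infinite, but only finitely many summands are nonzero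
  (see \<open>total_signal_finite\<close> below).\<close>

definition total_signal :: "nat \<Rightarrow> nat \<Rightarrow> vertex set \<Rightarrow> vertex \<Rightarrow> int" where
  "total_signal t r TT v = (\<Sum>\<^sub>\<infinity>T\<in>TT. tower_signal t r v T)"

definition broadcast :: "nat \<Rightarrow> nat \<Rightarrow> vertex set \<Rightarrow> bool" where
  "broadcast t r TT \<longleftrightarrow> (\<forall>v. total_signal t r TT v \<ge> int r)"

definition grid_square :: "nat \<Rightarrow> vertex set" where
  "grid_square n = {- int n..int n} \<times> {- int n..int n}"

definition has_broadcast_density :: "vertex set \<Rightarrow> real \<Rightarrow> bool" where
  "has_broadcast_density TT d \<longleftrightarrow>
     (\<lambda>n. real (card (TT \<inter> grid_square n)) / real (card (grid_square n))) \<longlonglongrightarrow> d"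

definition broadcast_densities :: "nat \<Rightarrow> nat \<Rightarrow> real set" where
  "broadcast_densities t r = {d. \<exists>TT. broadcast t r TT \<and> has_broadcast_density TT d}"

text \<open>The optimal density is a minimum, not merely an infimum. It is given as a relation, so
  that asserting its value includes asserting that the minimum is attained.\<close>

definition is_optimal_density :: "nat \<Rightarrow> nat \<Rightarrow> real \<Rightarrow> bool" where
  "is_optimal_density t r d \<longleftrightarrow>
     d \<in> broadcast_densities t r \<and> (\<forall>d' \<in> broadcast_densities t r. d \<le> d')"

lemma is_optimal_density_unique:
  "is_optimal_density t r d \<Longrightarrow> is_optimal_density t r d' \<Longrightarrow> d = d'"
  unfolding is_optimal_density_def by (meson order_antisym)

lemma is_optimal_density_Inf:
  "is_optimal_density t r d \<Longrightarrow> Inf (broadcast_densities t r) = d"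
  unfolding is_optimal_density_def by (intro cInf_eq_minimum) auto

lemma grid_adj_iff: "((a, b), (c, d)) \<in> grid_adj \<longleftrightarrow> \<bar>a - c\<bar> + \<bar>b - d\<bar> = 1"
proof -
  have "((a, b), (c, d)) \<in> grid_adj \<longleftrightarrow>
      sqrt ((real_of_int a - real_of_int c)\<^sup>2 + (real_of_int b - real_of_int d)\<^sup>2) = 1"
    by (simp add: grid_adj_def dist_prod_def dist_real_def)
  also have "\<dots> \<longleftrightarrow> real_of_int ((a - c)\<^sup>2 + (b - d)\<^sup>2) = 1"
    by simp
  also have "\<dots> \<longleftrightarrow> (a - c)\<^sup>2 + (b - d)\<^sup>2 = 1"
    by linarith
  also have "\<dots> \<longleftrightarrow> \<bar>a - c\<bar> + \<bar>b - d\<bar> = 1"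
  proof
    assume *: "(a - c)\<^sup>2 + (b - d)\<^sup>2 = 1"
    have "(a - c)\<^sup>2 = 0 \<or> (a - c)\<^sup>2 = 1"
      using * zero_le_power2[of "a - c"] zero_le_power2[of "b - d"] by linarith
    then show "\<bar>a - c\<bar> + \<bar>b - d\<bar> = 1"
      using * by (auto simp: power2_eq_1_iff)
  next
    assume *: "\<bar>a - c\<bar> + \<bar>b - d\<bar> = 1"
    then have "(\<bar>a - c\<bar> = 0 \<and> \<bar>b - d\<bar> = 1) \<or> (\<bar>a - c\<bar> = 1 \<and> \<bar>b - d\<bar> = 0)"
      by linarith
    then show "(a - c)\<^sup>2 + (b - d)\<^sup>2 = 1"
      by (metis power2_abs add_0 add.right_neutral one_power2 zero_power2)
  qed
  finally show ?thesis .
qed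

lemma grid_walk_lower:
  "((a, b), (c, d)) \<in> grid_adj ^^ n \<Longrightarrow> \<bar>a - c\<bar> + \<bar>b - d\<bar> \<le> int n"
proof (induction n arbitrary: c d)
  case (Suc n)
  then obtain e f where "((a, b), (e, f)) \<in> grid_adj ^^ n" "((e, f), (c, d)) \<in> grid_adj"
    by (metis relpow_Suc_E surj_pair)
  with Suc.IH[of e f] show ?case
    by (auto simp: grid_adj_iff)
qed simp

lemma grid_walk_exists:
  "\<bar>a - c\<bar> + \<bar>b - d\<bar> = int n \<Longrightarrow> ((a, b), (c, d)) \<in> grid_adj ^^ n"
proof (induction n arbitrary: a b)
  case (Suc n)
  define a' where "a' = (if a < c then a + 1 else if a > c then a - 1 else a)"
  define b' where "b' = (if a \<noteq> c then b else if b < d then b + 1 else b - 1)"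
  have "\<bar>a' - c\<bar> + \<bar>b' - d\<bar> = int n"
    using Suc.prems by (auto simp: a'_def b'_def)
  then have "((a', b'), (c, d)) \<in> grid_adj ^^ n"
    by (rule Suc.IH)
  moreover have "((a, b), (a', b')) \<in> grid_adj"
    using Suc.prems by (auto simp: grid_adj_iff a'_def b'_def)
  ultimately show ?case
    by (meson relpow_Suc_I2)
qed auto

lemma grid_dist_eq: "int (grid_dist (a, b) (c, d)) = \<bar>a - c\<bar> + \<bar>b - d\<bar>"
proof -
  have "grid_dist (a, b) (c, d) = nat (\<bar>a - c\<bar> + \<bar>b - d\<bar>)"
    unfolding grid_dist_def
    by (rule Least_equality) (auto intro: grid_walk_exists dest: grid_walk_lower)
  then show ?thesis by simp
qed

lemma finite_grid_ball: "finite {T. grid_dist v T < t}"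
proof (cases v)
  case (Pair a b)
  have "{T. grid_dist v T < t} \<subseteq> {a - int t..a + int t} \<times> {b - int t..b + int t}"
  proof clarify
    fix c d assume "grid_dist v (c, d) < t"
    then have "\<bar>a - c\<bar> + \<bar>b - d\<bar> < int t"
      using grid_dist_eq[of a b c d] Pair by simp
    then show "c \<in> {a - int t..a + int t} \<and> d \<in> {b - int t..b + int t}"
      by auto
  qed
  then show ?thesis
    by (rule finite_subset) simp
qed

lemma total_signal_finite:
  "total_signal t r TT v = (\<Sum>T | T \<in> TT \<and> grid_dist v T < t. tower_signal t r v T)"
proof -
  have "total_signal t r TT v = infsum (tower_signal t r v) {T. T \<in> TT \<and> grid_dist v T < t}"
    unfolding total_signal_def
    by (rule infsum_cong_neutral) (auto simp: tower_signal_def)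
  also have "\<dots> = sum (tower_signal t r v) {T. T \<in> TT \<and> grid_dist v T < t}"
    by (rule infsum_finite) (rule finite_subset[OF _ finite_grid_ball[of v t]], auto)
  finally show ?thesis .
qed

end

theory Submission
  imports Defs "HOL-Real_Asymp.Real_Asymp"
begin

text \<open>
  Put \<open>s = t - 1\<close>. A set of towers is a \<open>(t, 2)\<close> broadcast if every vertex has a tower at distance
  less than \<open>s\<close> or two towers at distance \<open>s\<close> (\<open>broadcast_iff_covering\<close>). Say that a tower covers
  an edge if both endpoints have distance at most \<open>s\<close>. In the coordinates \<open>x + y\<close> and \<open>x - y\<close> the
  edges of the grid are unit cells and the edges that a tower covers form a square of side
  \<open>2 * s\<close>; half of them, \<open>2 * s\<^sup>2\<close>, are horizontal. The vertices of the grid and the horizontal edges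
  have the same density, so the bound \<open>1 / (2 * s\<^sup>2)\<close> follows once a broadcast covers every
  horizontal edge at least once on average. The lattice of towers whose diamonds tile the plane
  covers every edge exactly once and attains the bound.

  A broadcast may leave edges uncovered; call such horizontal edges holes. The core of the
  proof is that holes are compensated by edges covered at least twice nearby: each hole claims one
  (\<open>claimable_hole\<close>), and no edge is claimed by two holes (\<open>claims_inj\<close>).
  Consider the hole between \<open>v = (0, 0)\<close> and \<open>v' = (1, 0)\<close>. Neither endpoint has a tower at distance
  less than \<open>s\<close>, so \<open>v\<close> has at least two towers at distance \<open>s\<close>, none of them to the right
  of \<open>v\<close>, and symmetrically for \<open>v'\<close>. If two towers of \<open>v\<close> lie strictly to the left of \<open>v\<close>, the
  edge on the other side of \<open>v\<close> is covered twice, and similarly for \<open>v'\<close>. Otherwise \<open>v\<close> has one of the towers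
  \<open>(0, s)\<close> and \<open>(0, -s)\<close>, and \<open>v'\<close> one of \<open>(1, s)\<close> and \<open>(1, -s)\<close>. Except when the other towers are
  in special positions, the edge above or below the hole is covered twice. In the
  special positions such an edge is found at most two columns and two rows away.
  The three kinds of claims are called straight, parallel and bent. They are told apart by the
  distances of the ends of the claimed edge from the nearest tower: at least \<open>s\<close> and less than \<open>s\<close>;
  \<open>s - 1\<close> and \<open>s - 1\<close>; \<open>s - 1\<close> and \<open>s - 2\<close>. Within each kind, the positions of the towers
  determine the hole.
\<close>

section \<open>Edges, holes and frames\<close>

text \<open>A relation \<open>Q\<close> on the integers is the set of towers, and \<open>s\<close> stands for \<open>t - 1\<close>. Distances
  are written out in coordinates. A vertex is clear if all towers have distance at least \<open>r\<close>.\<close>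

definition clear :: "int \<Rightarrow> (int \<Rightarrow> int \<Rightarrow> bool) \<Rightarrow> int \<Rightarrow> int \<Rightarrow> bool" where
  "clear r Q x y \<longleftrightarrow> (\<forall>i j. Q i j \<longrightarrow> r \<le> \<bar>x - i\<bar> + \<bar>y - j\<bar>)"

text \<open>A tower covers an edge if both endpoints have distance at most \<open>s\<close>. Only horizontal edges
  matter: two towers cover the edge between \<open>(x, y)\<close> and \<open>(x', y)\<close>.\<close>

definition two_cover :: "int \<Rightarrow> (int \<Rightarrow> int \<Rightarrow> bool) \<Rightarrow> int \<Rightarrow> int \<Rightarrow> int \<Rightarrow> bool" where
  "two_cover s Q x x' y \<longleftrightarrow> (\<exists>i j i' j'. Q i j \<and> Q i' j' \<and> (i, j) \<noteq> (i', j') \<and>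
     \<bar>x - i\<bar> + \<bar>y - j\<bar> \<le> s \<and> \<bar>x' - i\<bar> + \<bar>y - j\<bar> \<le> s \<and>
     \<bar>x - i'\<bar> + \<bar>y - j'\<bar> \<le> s \<and> \<bar>x' - i'\<bar> + \<bar>y - j'\<bar> \<le> s)"

text \<open>A hole is a horizontal edge that no tower covers.\<close>

definition hole :: "int \<Rightarrow> (int \<Rightarrow> int \<Rightarrow> bool) \<Rightarrow> int \<Rightarrow> int \<Rightarrow> int \<Rightarrow> bool" where
  "hole s Q x x' y \<longleftrightarrow> \<not> (\<exists>i j. Q i j \<and> \<bar>x - i\<bar> + \<bar>y - j\<bar> \<le> s \<and> \<bar>x' - i\<bar> + \<bar>y - j\<bar> \<le> s)"

text \<open>The condition that towers of strength \<open>s + 1\<close> form a broadcast with demand 2.\<close>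

definition covering :: "int \<Rightarrow> (int \<Rightarrow> int \<Rightarrow> bool) \<Rightarrow> bool" where
  "covering s Q \<longleftrightarrow> (\<forall>x y. clear s Q x y \<longrightarrow>
     (\<exists>i j i' j'. Q i j \<and> Q i' j' \<and> (i, j) \<noteq> (i', j') \<and>
        \<bar>x - i\<bar> + \<bar>y - j\<bar> = s \<and> \<bar>x - i'\<bar> + \<bar>y - j'\<bar> = s))"

text \<open>The set \<open>Q\<close> in the coordinates of a frame with origin \<open>(a, b)\<close> whose axes point in the
  directions \<open>e\<close> and \<open>n\<close> (signs).\<close>

definition frame :: "(int \<Rightarrow> int \<Rightarrow> bool) \<Rightarrow> int \<Rightarrow> int \<Rightarrow> int \<Rightarrow> int \<Rightarrow> int \<Rightarrow> int \<Rightarrow> bool" where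
  "frame Q a b e n = (\<lambda>i j. Q (a + e * i) (b + n * j))"

definition is_sign :: "int \<Rightarrow> bool" where
  "is_sign e \<longleftrightarrow> e = 1 \<or> e = -1"

lemma is_sign_simps [simp]: "is_sign 1" "is_sign (-1)" by (simp_all add: is_sign_def)

lemma is_sign_mult: "is_sign e \<Longrightarrow> is_sign f \<Longrightarrow> is_sign (e * f)"
  by (auto simp: is_sign_def)

lemma is_sign_square: "is_sign e \<Longrightarrow> e * e = 1" "is_sign e \<Longrightarrow> e * (e * x) = x"
  by (auto simp: is_sign_def)

lemma frame_frame: "frame (frame Q a b e n) a' b' e' n' =
    frame Q (a + e * a') (b + n * b') (e * e') (n * n')"
  by (simp add: frame_def algebra_simps)

lemma frame_onto:
  assumes "is_sign e" "is_sign n"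
  obtains i' j' where "i = a + e * i'" "j = b + n * j'"
  using that[of "e * (i - a)" "n * (j - b)"] is_sign_square assms by simp

lemma frame_abs:
  assumes "is_sign e"
  shows "\<bar>a + e * x - (a + e * i)\<bar> = \<bar>x - i\<bar>"
  using assms by (auto simp: is_sign_def)

lemma clear_frame:
  assumes "is_sign e" "is_sign n"
  shows "clear r (frame Q a b e n) x y \<longleftrightarrow> clear r Q (a + e * x) (b + n * y)"
proof
  assume L: "clear r (frame Q a b e n) x y"
  show "clear r Q (a + e * x) (b + n * y)"
    unfolding clear_def
  proof (intro allI impI)
    fix i j assume "Q i j"
    obtain i' j' where ij: "i = a + e * i'" "j = b + n * j'"
      using frame_onto[OF assms] .
    have "r \<le> \<bar>x - i'\<bar> + \<bar>y - j'\<bar>"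
      using L \<open>Q i j\<close> ij by (auto simp: clear_def frame_def)
    then show "r \<le> \<bar>a + e * x - i\<bar> + \<bar>b + n * y - j\<bar>"
      unfolding ij by (simp only: frame_abs assms)
  qed
next
  assume R: "clear r Q (a + e * x) (b + n * y)"
  show "clear r (frame Q a b e n) x y"
    unfolding clear_def frame_def
  proof (intro allI impI)
    fix i j assume "Q (a + e * i) (b + n * j)"
    with R have "r \<le> \<bar>a + e * x - (a + e * i)\<bar> + \<bar>b + n * y - (b + n * j)\<bar>"
      unfolding clear_def by blast
    then show "r \<le> \<bar>x - i\<bar> + \<bar>y - j\<bar>"
      by (simp only: frame_abs assms)
  qed
qed

lemma two_cover_frame:
  assumes "is_sign e" "is_sign n" "two_cover s (frame Q a b e n) x x' y"
  shows "two_cover s Q (a + e * x) (a + e * x') (b + n * y)"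
proof -
  obtain i j i' j' where *: "Q (a + e * i) (b + n * j)" "Q (a + e * i') (b + n * j')"
      "(i, j) \<noteq> (i', j')"
     "\<bar>x - i\<bar> + \<bar>y - j\<bar> \<le> s" "\<bar>x' - i\<bar> + \<bar>y - j\<bar> \<le> s"
     "\<bar>x - i'\<bar> + \<bar>y - j'\<bar> \<le> s" "\<bar>x' - i'\<bar> + \<bar>y - j'\<bar> \<le> s"
    using assms(3) unfolding two_cover_def frame_def by blast
  have "(a + e * i, b + n * j) \<noteq> (a + e * i', b + n * j')"
    using assms(1,2) *(3) by (auto simp: is_sign_def)
  moreover have "\<bar>a + e * x - (a + e * i)\<bar> + \<bar>b + n * y - (b + n * j)\<bar> \<le> s"
    "\<bar>a + e * x' - (a + e * i)\<bar> + \<bar>b + n * y - (b + n * j)\<bar> \<le> s"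
    "\<bar>a + e * x - (a + e * i')\<bar> + \<bar>b + n * y - (b + n * j')\<bar> \<le> s"
    "\<bar>a + e * x' - (a + e * i')\<bar> + \<bar>b + n * y - (b + n * j')\<bar> \<le> s"
    using *(4-7) by (simp_all only: frame_abs assms)
  ultimately show ?thesis
    using *(1,2) unfolding two_cover_def by blast
qed

lemma two_cover_sym: "two_cover s Q x x' y \<longleftrightarrow> two_cover s Q x' x y"
  unfolding two_cover_def by blast

lemma covering_frame:
  assumes "is_sign e" "is_sign n" "covering s Q"
  shows "covering s (frame Q a b e n)"
  unfolding covering_def
proof (intro allI impI)
  fix x y assume "clear s (frame Q a b e n) x y"
  then have "clear s Q (a + e * x) (b + n * y)"
    using clear_frame assms by blast
  with assms(3) obtain i j i' j' where *: "Q i j" "Q i' j'" "(i, j) \<noteq> (i', j')"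
     "\<bar>a + e * x - i\<bar> + \<bar>b + n * y - j\<bar> = s" "\<bar>a + e * x - i'\<bar> + \<bar>b + n * y - j'\<bar> = s"
    unfolding covering_def by meson
  obtain k l where kl: "i = a + e * k" "j = b + n * l" using frame_onto[OF assms(1,2)] .
  obtain k' l' where kl': "i' = a + e * k'" "j' = b + n * l'" using frame_onto[OF assms(1,2)] .
  have "frame Q a b e n k l" "frame Q a b e n k' l'" "(k, l) \<noteq> (k', l')"
    using *(1-3) kl kl' by (auto simp: frame_def)
  moreover have "\<bar>x - k\<bar> + \<bar>y - l\<bar> = s" "\<bar>x - k'\<bar> + \<bar>y - l'\<bar> = s"
    using *(4,5) unfolding kl kl' by (simp_all only: frame_abs assms)
  ultimately show "\<exists>i j i' j'. frame Q a b e n i j \<and> frame Q a b e n i' j' \<and> (i, j) \<noteq> (i', j') \<and>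
        \<bar>x - i\<bar> + \<bar>y - j\<bar> = s \<and> \<bar>x - i'\<bar> + \<bar>y - j'\<bar> = s"
    by blast
qed

lemma hole_frame:
  assumes "is_sign e" "is_sign n" "hole s Q (a + e * x) (a + e * x') (b + n * y)"
  shows "hole s (frame Q a b e n) x x' y"
  unfolding hole_def frame_def
proof
  assume "\<exists>i j. Q (a + e * i) (b + n * j) \<and> \<bar>x - i\<bar> + \<bar>y - j\<bar> \<le> s \<and> \<bar>x' - i\<bar> + \<bar>y - j\<bar> \<le> s"
  then obtain i j where *: "Q (a + e * i) (b + n * j)" "\<bar>x - i\<bar> + \<bar>y - j\<bar> \<le> s"
      "\<bar>x' - i\<bar> + \<bar>y - j\<bar> \<le> s"
    by blast
  then have "\<bar>a + e * x - (a + e * i)\<bar> + \<bar>b + n * y - (b + n * j)\<bar> \<le> s"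
    "\<bar>a + e * x' - (a + e * i)\<bar> + \<bar>b + n * y - (b + n * j)\<bar> \<le> s"
    by (simp_all only: frame_abs assms)
  with *(1) assms(3) show False unfolding hole_def by blast
qed

section \<open>Claims\<close>

text \<open>The patterns describe how a hole claims an edge that is covered twice. They are written
  in a frame in which the claimed edge joins \<open>(0, 0)\<close> and \<open>(1, 0)\<close>. In the straight pattern the hole
  joins \<open>(-1, 0)\<close> and \<open>(0, 0)\<close>.\<close>

definition straight :: "int \<Rightarrow> (int \<Rightarrow> int \<Rightarrow> bool) \<Rightarrow> bool" where
  "straight s Q \<longleftrightarrow> clear s Q 0 0 \<and> \<not> clear s Q 1 0"

text \<open>The hole joins \<open>(0, 1)\<close> and \<open>(1, 1)\<close>.\<close>

definition parallel :: "int \<Rightarrow> (int \<Rightarrow> int \<Rightarrow> bool) \<Rightarrow> bool" where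
  "parallel s Q \<longleftrightarrow> \<not> clear s Q 0 0 \<and> \<not> clear s Q 1 0 \<and> clear s Q 0 1 \<and> clear s Q 1 1 \<and>
     (Q 0 (1 - s) \<or> Q 1 (1 - s))"

text \<open>In the bent patterns, \<open>(0, 0)\<close> has distance \<open>s - 1\<close> and \<open>(1, 0)\<close> has distance \<open>s - 2\<close> from the
  nearest tower. Here the hole joins \<open>(-1, 1)\<close> and \<open>(0, 1)\<close>.\<close>

definition bent_pair :: "int \<Rightarrow> (int \<Rightarrow> int \<Rightarrow> bool) \<Rightarrow> bool" where
  "bent_pair s Q \<longleftrightarrow> clear s Q 0 1 \<and> clear s Q (-1) 1 \<and> Q 0 (1 - s) \<and> Q (-1) (1 + s) \<and>
     (\<exists>j. 1 \<le> j \<and> j < s \<and> Q j (1 - s + j))"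

text \<open>The next three patterns arise when the endpoint of the hole that is nearer to the claimed edge
  has only two towers at distance \<open>s\<close>, one straight above it and one at the same height. They
  differ in the position of a tower at distance \<open>s\<close> from the vertex below this endpoint: straight
  below that vertex, one column to the side, or farther to the side. In the first of them the
  hole joins \<open>(0, 2)\<close> and \<open>(1, 2)\<close>.\<close>

definition bent_below :: "int \<Rightarrow> (int \<Rightarrow> int \<Rightarrow> bool) \<Rightarrow> bool" where
  "bent_below s Q \<longleftrightarrow> clear s Q 0 2 \<and> clear s Q 1 2 \<and> clear s Q 0 1 \<and> Q 1 (2 - s) \<and> Q 0 (1 - s)
      \<and> Q (-s) 2 \<and>
     (\<forall>i j. Q i j \<and> \<bar>i\<bar> + \<bar>j - 2\<bar> = s \<longrightarrow> (i, j) = (0, 2 + s) \<or> (i, j) = (-s, 2))"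

text \<open>The hole joins \<open>(0, 2)\<close> and \<open>(c, 2)\<close> with \<open>c = 1\<close> or \<open>c = -1\<close>. The two towers below are
  symmetric, so both edges from \<open>(0, 0)\<close>, the fork, are covered twice.\<close>

definition bent_fork :: "int \<Rightarrow> int \<Rightarrow> (int \<Rightarrow> int \<Rightarrow> bool) \<Rightarrow> bool" where
  "bent_fork c s Q \<longleftrightarrow> clear s Q 0 2 \<and> clear s Q c 2 \<and> clear s Q 0 1 \<and> Q 1 (2 - s) \<and> Q (-1) (2 - s)
      \<and> Q (- c * s) 2"

text \<open>The hole joins \<open>(-2, 1)\<close> and \<open>(-1, 1)\<close>.\<close>

definition bent_side :: "int \<Rightarrow> (int \<Rightarrow> int \<Rightarrow> bool) \<Rightarrow> bool" where
  "bent_side s Q \<longleftrightarrow> clear s Q (-1) 1 \<and> clear s Q (-2) 1 \<and> clear s Q (-1) 0 \<and> Q (-1) (1 + s)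
      \<and> Q (s - 1) 1 \<and>
     Q (-2) (1 - s) \<and> (\<exists>k m. 2 \<le> k \<and> 0 \<le> m \<and> k + m = s \<and> Q (k - 1) (-m))"

text \<open>Disjunction of the four bent patterns. The hole meant is the horizontal edge with midpoint
  \<open>(c / 2, d)\<close>. When \<open>s = 2\<close>, a fork can be demanded by a hole above it and by one below it; both
  edges of the fork are then covered twice, and the condition \<open>w = 1\<close> gives one to each.\<close>

definition bent :: "int \<Rightarrow> int \<Rightarrow> (int \<Rightarrow> int \<Rightarrow> bool) \<Rightarrow> int \<Rightarrow> int \<Rightarrow> bool" where
  "bent w s Q c d \<longleftrightarrow>
     bent_pair s Q \<and> c = -1 \<and> d = 1 \<or>
     bent_below s Q \<and> c = 1 \<and> d = 2 \<or>
     bent_fork c s Q \<and> is_sign c \<and> d = 2 \<and> w = 1 \<or>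
     bent_side s Q \<and> c = -3 \<and> d = 1"

definition pattern :: "int \<Rightarrow> int \<Rightarrow> (int \<Rightarrow> int \<Rightarrow> bool) \<Rightarrow> int \<Rightarrow> int \<Rightarrow> bool" where
  "pattern w s Q c d \<longleftrightarrow>
     straight s Q \<and> c = -1 \<and> d = 0 \<or>
     parallel s Q \<and> c = 1 \<and> d = 1 \<or>
     bent w s Q c d"

text \<open>The hole in row \<open>y\<close> claims the edge in row \<open>z\<close>. The numbers \<open>h\<close> and \<open>k\<close> are twice the
  abscissa of the midpoint of the hole and of the claimed edge; in this form the relation is
  compatible with all frames. The number \<open>w\<close> is a sign that changes under reflections: with the
  same \<open>w\<close> for all holes, the edge of a fork that points in direction \<open>e\<close> is reserved for
  holes on the side \<open>n = w * e\<close>.\<close>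

definition claims :: "int \<Rightarrow> int \<Rightarrow> (int \<Rightarrow> int \<Rightarrow> bool) \<Rightarrow> int \<Rightarrow> int \<Rightarrow> int \<Rightarrow> int \<Rightarrow> bool" where
  "claims w s Q h y k z \<longleftrightarrow> (\<exists>a e n c d. is_sign e \<and> is_sign n \<and> k = 2 * a + e \<and>
     h = 2 * a + e * c \<and> y = z + n * d \<and>
     two_cover s Q a (a + e) z \<and> pattern (w * e * n) s (frame Q a z e n) c d)"

lemma claims_frame:
  assumes "is_sign f" "is_sign m" "claims w s (frame Q a' b' f m) h y k z"
  shows "claims (w * f * m) s Q (2 * a' + f * h) (b' + m * y) (2 * a' + f * k) (b' + m * z)"
proof -
  obtain a e n c d where *: "is_sign e" "is_sign n" "k = 2 * a + e" "h = 2 * a + e * c"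
      "y = z + n * d"
     "two_cover s (frame Q a' b' f m) a (a + e) z"
     "pattern (w * e * n) s (frame (frame Q a' b' f m) a z e n) c d"
    using assms(3) unfolding claims_def by blast
  have "two_cover s Q (a' + f * a) (a' + f * (a + e)) (b' + m * z)"
    using two_cover_frame assms(1,2) *(6) by blast
  moreover have "w * f * m * (f * e) * (m * n) = w * e * n"
    using assms(1,2) by (auto simp: is_sign_def)
  moreover have "is_sign (f * e)" "is_sign (m * n)"
    using assms(1,2) *(1,2) by (simp_all add: is_sign_mult)
  moreover have "2 * a' + f * k = 2 * (a' + f * a) + f * e"
    "2 * a' + f * h = 2 * (a' + f * a) + f * e * c"
    "b' + m * y = b' + m * z + m * n * d"
    "a' + f * (a + e) = a' + f * a + f * e"
    using *(3-5) by (simp_all add: algebra_simps)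
  ultimately show ?thesis
    using *(7) unfolding claims_def frame_frame by metis
qed

section \<open>An edge is claimed by at most one hole\<close>

lemma clearD: "clear r Q x y \<Longrightarrow> Q i j \<Longrightarrow> r \<le> \<bar>x - i\<bar> + \<bar>y - j\<bar>"
  unfolding clear_def by blast

lemma clear_neighbour:
  assumes "clear s Q x y" "\<bar>x - x'\<bar> + \<bar>y - y'\<bar> = 1"
  shows "clear (s - 1) Q x' y'"
  unfolding clear_def
proof (intro allI impI)
  fix i j assume "Q i j"
  from clearD[OF assms(1) this] assms(2) show "s - 1 \<le> \<bar>x' - i\<bar> + \<bar>y' - j\<bar>" by linarith
qed

lemma clear_mono: "clear r Q x y \<Longrightarrow> r' \<le> r \<Longrightarrow> clear r' Q x y"
  unfolding clear_def by (meson order_trans)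

text \<open>The distances of the two ends of the claimed edge from the nearest tower tell the straight,
  the parallel and the bent patterns apart, and they orient the edge in the first and the last
  case.\<close>

lemma bent_profile:
  assumes "s \<ge> 2" "bent w s Q c d"
  shows "clear (s - 1) Q 0 0" "\<not> clear (s - 1) Q 1 0" "\<not> clear s Q 0 0" "\<not> clear s Q 1 0"
proof -
  have "clear s Q 0 1 \<or> clear s Q (-1) 0"
    using assms(2) unfolding bent_def bent_pair_def bent_below_def bent_fork_def bent_side_def
      by blast
  then have A: "clear (s - 1) Q 0 0"
    using clear_neighbour[of s Q 0 1 0 0] clear_neighbour[of s Q "-1" 0 0 0] by auto
  have "\<exists>i j. Q i j \<and> \<bar>i\<bar> + \<bar>j\<bar> \<le> s - 1 \<and> \<bar>1 - i\<bar> + \<bar>j\<bar> \<le> s - 2"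
    using assms(2) unfolding bent_def
  proof (elim disjE conjE)
    assume "bent_pair s Q"
    then obtain j where "1 \<le> j" "j < s" "Q j (1 - s + j)" unfolding bent_pair_def by blast
    then show ?thesis by (intro exI[of _ j] exI[of _ "1 - s + j"]) auto
  next
    assume "bent_below s Q"
    then have "Q 1 (2 - s)" unfolding bent_below_def by blast
    then show ?thesis using assms(1) by (intro exI[of _ 1] exI[of _ "2 - s"]) auto
  next
    assume "bent_fork c s Q"
    then have "Q 1 (2 - s)" unfolding bent_fork_def by blast
    then show ?thesis using assms(1) by (intro exI[of _ 1] exI[of _ "2 - s"]) auto
  next
    assume "bent_side s Q"
    then obtain k m where "2 \<le> k" "0 \<le> m" "k + m = s" "Q (k - 1) (-m)" unfolding bent_side_def
      by blast
    then show ?thesis by (intro exI[of _ "k - 1"] exI[of _ "- m"]) auto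
  qed
  then obtain i j where ij: "Q i j" "\<bar>i\<bar> + \<bar>j\<bar> \<le> s - 1" "\<bar>1 - i\<bar> + \<bar>j\<bar> \<le> s - 2" by blast
  show "clear (s - 1) Q 0 0" by (fact A)
  show *: "\<not> clear (s - 1) Q 1 0" using clearD[of "s - 1" Q 1 0, OF _ ij(1)] ij(3) by auto
  show "\<not> clear s Q 0 0" using clearD[of s Q 0 0, OF _ ij(1)] ij(2) by auto
  show "\<not> clear s Q 1 0" using clear_mono[of s Q 1 0 "s - 1"] * by auto
qed

lemma parallel_profile:
  assumes "parallel s Q"
  shows "clear (s - 1) Q 0 0" "clear (s - 1) Q 1 0" "\<not> clear s Q 0 0" "\<not> clear s Q 1 0"
  using assms clear_neighbour[of s Q 0 1 0 0] clear_neighbour[of s Q 1 1 1 0]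
  unfolding parallel_def by simp_all

lemma too_close: "clear s Q x y \<Longrightarrow> Q i j \<Longrightarrow> \<bar>x - i\<bar> + \<bar>y - j\<bar> < s \<Longrightarrow> R"
  using clearD by fastforce

text \<open>Two bent patterns in the same frame point to the same hole. Otherwise a tower of one pattern
  would be too close to a hole endpoint of the other one or, for \<open>bent_pair\<close> and \<open>bent_below\<close>,
  the tower above the first hole would be a third tower at distance \<open>s\<close> from an endpoint of the
  second.\<close>

lemma bent_same:
  assumes s: "s \<ge> 2" and 1: "bent w s Q c d" and 2: "bent w' s Q c' d'"
  shows "c = c' \<and> d = d'"
proof -
  have a: False if "bent_pair s Q" "bent_below s Q"
    using that s unfolding bent_pair_def bent_below_def by fastforce
  have b: False if "bent_pair s Q" "bent_fork c s Q" for c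
    using that s unfolding bent_pair_def bent_fork_def by (elim conjE)
      (erule too_close[of s Q "-1" 1 "-1" "2 - s"], auto)
  have c: False if "bent_pair s Q" "bent_side s Q"
    using that s unfolding bent_pair_def bent_side_def by (elim conjE)
      (erule too_close[of s Q 0 1 "s - 1" 1], auto)
  have d: "c = 1" if "bent_below s Q" "bent_fork c s Q" "is_sign c" for c
  proof (rule ccontr)
    assume "c \<noteq> 1"
    then have "Q s 2" "clear s Q 1 2" using that unfolding bent_below_def bent_fork_def
      by (auto simp: is_sign_def)
    then show False using s by (elim too_close) auto
  qed
  have e: False if "bent_below s Q" "bent_side s Q"
    using that s unfolding bent_below_def bent_side_def by (elim conjE)
      (erule too_close[of s Q 1 2 "s - 1" 1], auto)
  have f: False if "bent_fork c s Q" "bent_side s Q" for c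
    using that s unfolding bent_fork_def bent_side_def by (elim conjE)
      (erule too_close[of s Q "-1" 1 "-1" "2 - s"], auto)
  have g: "c = c'" if "bent_fork c s Q" "bent_fork c' s Q" "is_sign c" "is_sign c'" for c c'
  proof (rule ccontr)
    assume "c \<noteq> c'"
    then have "Q s 2" "clear s Q 1 2" using that unfolding bent_fork_def by (auto simp: is_sign_def)
    then show False using s by (elim too_close) auto
  qed
  show ?thesis
    using 1 2 unfolding bent_def by (auto dest: a b c d e f g)
qed

text \<open>No two bent patterns on opposite sides claim the same edge. Two forks are excluded by the
  sign \<open>w\<close>, all other pairs because a tower is too close to a clear vertex.\<close>

lemma bent_mirror:
  assumes s: "s \<ge> 2" and 1: "bent w s Q c d" and 2: "bent (- w) s (frame Q 0 0 1 (-1)) c' d'"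
  shows False
proof -
  define R where "R = frame Q 0 0 1 (-1)"
  have R: "R i j = Q i (- j)" for i j by (simp add: R_def frame_def)
  have cl: "clear s R x y = clear s Q x (- y)" for x y by (simp add: R_def clear_frame)
  note defs = bent_pair_def bent_below_def bent_fork_def bent_side_def cl R
  have 11: False if "bent_pair s Q" "bent_pair s R"
    using that s unfolding defs by (elim conjE) (erule too_close[of s Q 0 "-1" 0 "1 - s"], auto)
  have 12: False if "bent_pair s Q" "bent_below s R"
    using that s unfolding defs by (elim conjE) (erule too_close[of s Q 0 1 0 "-(1 - s)"], auto)
  have 13: False if "bent_pair s Q" "bent_fork c s R" for c
    using that s unfolding defs by (elim conjE)
      (erule too_close[of s Q "-1" 1 "-1" "-(2 - s)"], auto)
  have 14: False if "bent_pair s Q" "bent_side s R"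
    using that s unfolding defs by (elim conjE) (erule too_close[of s Q "-1" "-1" 0 "1 - s"], auto)
  have 21: False if "bent_below s Q" "bent_pair s R"
    using that s unfolding defs by (elim conjE) (erule too_close[of s Q 0 "-1" 0 "1 - s"], auto)
  have 22: False if "bent_below s Q" "bent_below s R"
    using that s unfolding defs by (elim conjE) (erule too_close[of s Q 0 "-2" 0 "1 - s"], auto)
  have 23: False if "bent_below s Q" "bent_fork c s R" for c
    using that s unfolding defs by (elim conjE) (erule too_close[of s Q 0 "-2" 0 "1 - s"], auto)
  have 24: False if "bent_below s Q" "bent_side s R"
    using that s unfolding defs by (elim conjE) (erule too_close[of s Q "-1" "-1" 0 "1 - s"], auto)
  have 31: False if "bent_fork c s Q" "bent_pair s R" for c
    using that s unfolding defs by (elim conjE)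
      (erule too_close[of s Q "-1" "-1" "-1" "2 - s"], auto)
  have 32: False if "bent_fork c s Q" "bent_below s R" for c
    using that s unfolding defs by (elim conjE) (erule too_close[of s Q 0 2 0 "-(1 - s)"], auto)
  have 34: False if "bent_fork c s Q" "bent_side s R" for c
    using that s unfolding defs by (elim conjE)
      (erule too_close[of s Q "-1" "-1" "-1" "2 - s"], auto)
  have 41: False if "bent_side s Q" "bent_pair s R"
    using that s unfolding defs by (elim conjE) (erule too_close[of s Q "-1" 1 0 "-(1 - s)"], auto)
  have 42: False if "bent_side s Q" "bent_below s R"
    using that s unfolding defs by (elim conjE) (erule too_close[of s Q "-1" 1 0 "-(1 - s)"], auto)
  have 43: False if "bent_side s Q" "bent_fork c s R" for c
    using that s unfolding defs by (elim conjE)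
      (erule too_close[of s Q "-1" 1 "-1" "-(2 - s)"], auto)
  have 44: False if "bent_side s Q" "bent_side s R"
    using that s unfolding defs by (elim conjE)
      (erule too_close[of s Q "-2" "-1" "-2" "1 - s"], auto)
  show False
    using 1 2 unfolding bent_def R_def[symmetric]
    by (elim disjE conjE) (use 11 12 13 14 21 22 23 24 31 32 34 41 42 43 44 in \<open>blast | simp\<close>)+
qed

lemma frame_id: "frame Q 0 0 1 1 = Q"
  by (simp add: frame_def)

lemma parallel_mirror:
  assumes s: "s \<ge> 2" and "parallel s Q" "clear s Q 0 (-1)" "clear s Q 1 (-1)"
  shows False
  using assms(2) unfolding parallel_def
proof (elim conjE disjE)
  assume "Q 0 (1 - s)" from too_close[OF assms(3) this] s show False by simp
next
  assume "Q 1 (1 - s)" from too_close[OF assms(4) this] s show False by simp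
qed

text \<open>Two patterns for the same edge describe the same hole. The first one is written in its own
  frame; relative to that frame, there are four frames for the second one, since the edge can be
  read in both directions and the vertical axis can point up or down.\<close>

lemma pattern_unique:
  assumes s: "s \<ge> 2" and 1: "pattern w s Q c d"
    and 2: "pattern (w * e * n) s (frame Q a 0 e n) c' d'"
    and e: "a = 0 \<and> e = 1 \<or> a = 1 \<and> e = -1" and n: "is_sign n"
  shows "c = 2 * a + e * c' \<and> d = n * d'"
proof -
  define R where "R = frame Q a 0 e n"
  have "is_sign e" using e by auto
  then have cl: "clear r R x y = clear r Q (a + e * x) (n * y)" for r x y
    by (simp add: R_def clear_frame n)
  note 2 = 2[folded R_def]
  from 1 2 show ?thesis
    unfolding pattern_def
  proof (elim disjE conjE)
    assume "straight s Q" "straight s R" "c = -1" "d = 0" "c' = -1" "d' = 0"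
    then show ?thesis using e by (auto simp: straight_def cl)
  next
    assume "straight s Q" "parallel s R"
    then show ?thesis using e parallel_profile[of s R] by (auto simp: straight_def cl)
  next
    assume *: "straight s Q" "bent (w * e * n) s R c' d'"
    then show ?thesis using e bent_profile[OF s *(2)] by (auto simp: straight_def cl)
  next
    assume "parallel s Q" "straight s R"
    then show ?thesis using e parallel_profile[of s Q] by (auto simp: straight_def cl)
  next
    assume *: "parallel s Q" "parallel s R" "c = 1" "d = 1" "c' = 1" "d' = 1"
    then have "clear s Q 0 n \<and> clear s Q 1 n"
      using e by (auto simp: parallel_def cl)
    then have "n = 1"
      using parallel_mirror[OF s *(1)] n by (auto simp: is_sign_def)
    then show ?thesis using * e by auto
  next
    assume *: "parallel s Q" "bent (w * e * n) s R c' d'"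
    then show ?thesis
      using e parallel_profile[of s Q] bent_profile[OF s *(2)] by (auto simp: cl)
  next
    assume *: "bent w s Q c d" "straight s R"
    then show ?thesis using e bent_profile[OF s *(1)] by (auto simp: straight_def cl)
  next
    assume *: "bent w s Q c d" "parallel s R"
    then show ?thesis
      using e parallel_profile[of s R] bent_profile[OF s *(1)] by (auto simp: cl)
  next
    assume *: "bent w s Q c d" "bent (w * e * n) s R c' d'"
    then have "e = 1" "a = 0"
      using e bent_profile[OF s *(1)] bent_profile[OF s *(2)] by (auto simp: cl)
    moreover have "n = 1"
      using bent_mirror[OF s *(1)] *(2) n \<open>e = 1\<close> \<open>a = 0\<close> by (auto simp: is_sign_def R_def)
    moreover have "R = Q"
      using \<open>e = 1\<close> \<open>a = 0\<close> \<open>n = 1\<close> by (simp add: R_def frame_id)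
    ultimately show ?thesis
      using bent_same[OF s *(1)] *(2) by auto
  qed
qed

lemma claims_inj:
  assumes s: "s \<ge> 2" and w: "is_sign w" and 1: "claims w s Q h y k z" and 2: "claims w s Q h' y' k
      z"
  shows "h = h' \<and> y = y'"
proof -
  obtain a e n c d where *: "is_sign e" "is_sign n" "k = 2 * a + e" "h = 2 * a + e * c"
      "y = z + n * d"
     "pattern (w * e * n) s (frame Q a z e n) c d"
    using 1 unfolding claims_def by blast
  obtain a' e' n' c' d' where **: "is_sign e'" "is_sign n'" "k = 2 * a' + e'"
      "h' = 2 * a' + e' * c'" "y' = z + n' * d'"
     "pattern (w * e' * n') s (frame Q a' z e' n') c' d'"
    using 2 unfolding claims_def by blast
  define R where "R = frame Q a z e n"
  define \<alpha> where "\<alpha> = e * (a' - a)"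
  define \<epsilon> where "\<epsilon> = e * e'"
  define \<nu> where "\<nu> = n * n'"
  have eq: "a' = a + e * \<alpha>" "e' = e * \<epsilon>" "n' = n * \<nu>"
    using *(1,2) by (simp_all add: \<alpha>_def \<epsilon>_def \<nu>_def is_sign_square)
  have "frame Q a' z e' n' = frame R \<alpha> 0 \<epsilon> \<nu>"
    by (simp add: R_def frame_frame eq)
  moreover have "w * e' * n' = (w * e * n) * \<epsilon> * \<nu>"
    by (simp add: eq)
  moreover have "\<alpha> = 0 \<and> \<epsilon> = 1 \<or> \<alpha> = 1 \<and> \<epsilon> = -1"
    using *(1,3) **(1,3) by (auto simp: is_sign_def \<alpha>_def \<epsilon>_def)
  moreover have "is_sign \<nu>" using *(2) **(2) by (simp add: \<nu>_def is_sign_mult)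
  ultimately have "c = 2 * \<alpha> + \<epsilon> * c' \<and> d = \<nu> * d'"
    using pattern_unique[OF s *(6)] **(6) R_def by metis
  then show ?thesis
    using *(4,5) **(4,5) eq by (simp add: algebra_simps)
qed

section \<open>Every hole claims an edge\<close>

text \<open>The horizontal edge with doubled midpoint abscissa \<open>h\<close> in row \<open>y\<close>, in applications a hole,
  has an edge to claim.\<close>

definition claimable :: "int \<Rightarrow> int \<Rightarrow> (int \<Rightarrow> int \<Rightarrow> bool) \<Rightarrow> int \<Rightarrow> int \<Rightarrow> bool" where
  "claimable w s Q h y \<longleftrightarrow> (\<exists>k z. claims w s Q h y k z)"

lemma claimable_frame:
  assumes "is_sign f" "is_sign m" "claimable w s (frame Q a b f m) h y"
    "w' = w * f * m" "h' = 2 * a + f * h" "y' = b + m * y"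
  shows "claimable w' s Q h' y'"
  using claims_frame assms unfolding claimable_def by blast

lemma claimableI:
  assumes "is_sign e" "is_sign n" "two_cover s Q a (a + e) z"
      "pattern (w * e * n) s (frame Q a z e n) c d"
    "h = 2 * a + e * c" "y = z + n * d"
  shows "claimable w s Q h y"
  unfolding claimable_def claims_def using assms by blast

lemma two_coverI:
  assumes "Q i j" "Q i' j'" "(i, j) \<noteq> (i', j')"
     "\<bar>x - i\<bar> + \<bar>y - j\<bar> \<le> s" "\<bar>x' - i\<bar> + \<bar>y - j\<bar> \<le> s"
     "\<bar>x - i'\<bar> + \<bar>y - j'\<bar> \<le> s" "\<bar>x' - i'\<bar> + \<bar>y - j'\<bar> \<le> s"
  shows "two_cover s Q x x' y"
  unfolding two_cover_def using assms by blast

lemma not_clearI: "Q i j \<Longrightarrow> \<bar>x - i\<bar> + \<bar>y - j\<bar> < r \<Longrightarrow> \<not> clear r Q x y"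
  unfolding clear_def by fastforce

text \<open>No tower has distance less than \<open>s\<close> from an endpoint of a hole, and those at distance \<open>s\<close> lie
  on the side away from the other endpoint.\<close>

lemma holeD:
  assumes "hole s Q 0 1 0" "Q i j"
  shows "s \<le> \<bar>i\<bar> + \<bar>j\<bar>" "s \<le> \<bar>1 - i\<bar> + \<bar>j\<bar>"
    "\<bar>i\<bar> + \<bar>j\<bar> = s \<Longrightarrow> i \<le> 0" "\<bar>1 - i\<bar> + \<bar>j\<bar> = s \<Longrightarrow> i \<ge> 1"
proof -
  have "\<not> (\<bar>i\<bar> + \<bar>j\<bar> \<le> s \<and> \<bar>1 - i\<bar> + \<bar>j\<bar> \<le> s)"
    using assms unfolding hole_def by force
  then show "s \<le> \<bar>i\<bar> + \<bar>j\<bar>" "s \<le> \<bar>1 - i\<bar> + \<bar>j\<bar>"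
    "\<bar>i\<bar> + \<bar>j\<bar> = s \<Longrightarrow> i \<le> 0" "\<bar>1 - i\<bar> + \<bar>j\<bar> = s \<Longrightarrow> i \<ge> 1"
    by linarith+
qed

lemma hole_clear: "hole s Q 0 1 0 \<Longrightarrow> clear s Q 0 0" "hole s Q 0 1 0 \<Longrightarrow> clear s Q 1 0"
  unfolding clear_def using holeD by simp_all

lemma hole_rotate: "hole s Q 0 1 0 \<Longrightarrow> hole s (frame Q 1 0 (-1) (-1)) 0 1 0"
  by (intro hole_frame) (simp_all add: hole_def conj_commute)

lemma hole_mirror: "hole s Q 0 1 0 \<Longrightarrow> hole s (frame Q 0 0 1 (-1)) 0 1 0"
  by (intro hole_frame) simp_all

lemma claimable_rotate: "claimable w s (frame Q 1 0 (-1) (-1)) 1 0 \<Longrightarrow> claimable w s Q 1 0"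
  by (erule claimable_frame[rotated 2]) auto

lemma claimable_mirror: "claimable (- w) s (frame Q 0 0 1 (-1)) 1 0 \<Longrightarrow> claimable w s Q 1 0"
  by (erule claimable_frame[rotated 2]) auto

lemma claim_straight:
  assumes "hole s Q 0 1 0" "Q i j" "Q i' j'" "(i, j) \<noteq> (i', j')"
    "\<bar>i\<bar> + \<bar>j\<bar> = s" "\<bar>i'\<bar> + \<bar>j'\<bar> = s" "i < 0" "i' < 0"
  shows "claimable w s Q 1 0"
proof (rule claimableI[of "-1" 1 s Q 0 0 w "-1" 0])
  show "two_cover s Q 0 (0 + -1) 0"
    using assms by (intro two_coverI[of Q i j i' j']) auto
  have "\<not> clear s Q (-1) 0"
    using assms by (intro not_clearI[of Q i j]) auto
  then show "pattern (w * - 1 * 1) s (frame Q 0 0 (- 1) 1) (- 1) 0"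
    using hole_clear[OF assms(1)] by (simp add: pattern_def straight_def clear_frame)
qed auto

lemma claim_parallel:
  assumes "s \<ge> 2" "hole s Q 0 1 0" "Q 0 s \<or> Q 1 s" "two_cover s Q 0 1 1" "\<not> clear s Q 0 1"
      "\<not> clear s Q 1 1"
  shows "claimable w s Q 1 0"
proof (rule claimableI[of 1 "-1" s Q 0 1 w 1 1])
  show "two_cover s Q 0 (0 + 1) 1" using assms by simp
  have "parallel s (frame Q 0 1 1 (-1))"
    using assms hole_clear[OF assms(2)] unfolding parallel_def
      by (simp add: clear_frame) (simp add: frame_def)
  then show "pattern (w * 1 * - 1) s (frame Q 0 1 1 (- 1)) 1 1"
    by (simp add: pattern_def bent_def)
qed auto

lemma claim_bent_pair:
  assumes "s \<ge> 2" "hole s Q 0 1 0" "Q 0 s" "Q 1 (-s)" "1 \<le> j" "j < s" "Q (1 + j) (j - s)"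
  shows "claimable w s Q 1 0"
proof (rule claimableI[of 1 1 s Q 1 "-1" w "-1" 1])
  show "two_cover s Q 1 (1 + 1) (-1)"
    using assms by (intro two_coverI[of Q 1 "-s" "1 + j" "j - s"]) auto
  have "bent_pair s (frame Q 1 (-1) 1 1)"
    using assms(3-7) hole_clear[OF assms(2)] unfolding bent_pair_def
    by (simp add: clear_frame) (auto simp: frame_def intro!: exI[of _ j])
  then show "pattern (w * 1 * 1) s (frame Q 1 (-1) 1 1) (-1) 1"
    by (simp add: pattern_def bent_def)
qed auto

lemma two_at:
  assumes "covering s Q" "clear s Q x y"
  obtains i j where "Q i j" "(i, j) \<noteq> p" "\<bar>x - i\<bar> + \<bar>y - j\<bar> = s"
proof -
  from assms obtain i j i' j' where *: "Q i j" "Q i' j'" "(i, j) \<noteq> (i', j')"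
     "\<bar>x - i\<bar> + \<bar>y - j\<bar> = s" "\<bar>x - i'\<bar> + \<bar>y - j'\<bar> = s"
    unfolding covering_def by meson
  show ?thesis
    by (cases "(i, j) = p") (use * that[of i j] that[of i' j'] in auto)
qed

text \<open>The hardest situation: the only towers at distance \<open>s\<close> from the endpoints are those straight
  above and at the same height to the left of \<open>(0, 0)\<close>, and those straight below and at the same
  height to the right of \<open>(1, 0)\<close>. Then \<open>(0, -1)\<close> also has distance \<open>s\<close> from the nearest tower, and the
  second tower \<open>(-k, -1 - m)\<close> at that distance overlaps with one of the others.\<close>

lemma claim_corners:
  assumes s: "s \<ge> 2" and cov: "covering s Q" and h: "hole s Q 0 1 0"
    and T: "Q 0 s" "Q (-s) 0" "Q 1 (-s)"
    and only0: "\<And>i j. Q i j \<Longrightarrow> \<bar>i\<bar> + \<bar>j\<bar> = s \<Longrightarrow> (i, j) = (0, s) \<or> (i, j) = (-s, 0)"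
    and only1: "\<And>i j. Q i j \<Longrightarrow> \<bar>1 - i\<bar> + \<bar>j\<bar> = s \<Longrightarrow> (i, j) = (1, -s) \<or> (i, j) = (1 + s, 0)"
    and w: "is_sign w"
  shows "claimable w s Q 1 0"
proof -
  have cl: "clear s Q 0 (-1)"
    unfolding clear_def
  proof (intro allI impI, rule ccontr)
    fix i j assume "Q i j" "\<not> s \<le> \<bar>0 - i\<bar> + \<bar>- 1 - j\<bar>"
    moreover from holeD(1)[OF h this(1)] this have "\<bar>i\<bar> + \<bar>j\<bar> = s" by linarith
    ultimately show False using only0[of i j] s by auto
  qed
  obtain i j where ij: "Q i j" "(i, j) \<noteq> (1, -s)" "\<bar>i\<bar> + \<bar>- 1 - j\<bar> = s"
    using two_at[OF cov cl, of "(1, -s)"] by auto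
  have "\<bar>i\<bar> + \<bar>j\<bar> \<noteq> s"
    using only0[OF ij(1)] ij(3) s by auto
  then have j: "j \<le> -1"
    using holeD(1)[OF h ij(1)] ij(3) by linarith
  have i: "i \<le> 0"
  proof (rule ccontr)
    assume "\<not> i \<le> 0"
    then have "\<bar>1 - i\<bar> + \<bar>j\<bar> = s" using ij(3) j by linarith
    with only1[OF ij(1)] ij j show False using s by auto
  qed
  define k where "k = - i"
  define m where "m = - 1 - j"
  have km: "k \<ge> 0" "m \<ge> 0" "k + m = s" "Q (- k) (- 1 - m)"
    using i j ij by (auto simp: k_def m_def)
  note clears = hole_clear[OF h] cl
  consider "k = 0" | "k = 1" | "k \<ge> 2" using km(1) by linarith
  then show ?thesis
  proof cases
    case 1
    show ?thesis
    proof (rule claimableI[of 1 1 s Q 0 "-2" w 1 2])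
      have Q: "Q 0 (- 1 - s)" using 1 km by simp
      then show "two_cover s Q 0 (0 + 1) (-2)"
        using T(3) s by (intro two_coverI[of Q 1 "-s" 0 "-1 - s"]) auto
      have "(i, j) = (0, 2 + s) \<or> (i, j) = (-s, 2)"
        if "frame Q 0 (-2) 1 1 i j" "\<bar>i\<bar> + \<bar>j - 2\<bar> = s" for i j
        using only0[of i "j - 2"] that by (auto simp: frame_def)
      then have "bent_below s (frame Q 0 (-2) 1 1)"
        using T clears Q unfolding bent_below_def
        by (simp add: clear_frame) (simp add: frame_def)
      then show "pattern (w * 1 * 1) s (frame Q 0 (-2) 1 1) 1 2"
        by (simp add: pattern_def bent_def)
    qed auto
  next
    case 2
    \<comment> \<open>Both edges from \<open>(0, -2)\<close> are covered twice; \<open>w\<close> selects the one to be claimed.\<close>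
    have Q: "Q (-1) (- s)" using 2 km by (metis add.commute minus_add_distrib uminus_add_conv_diff)
    show ?thesis
    proof (rule claimableI[of w 1 s Q 0 "-2" w w 2])
      show "two_cover s Q 0 (0 + w) (-2)"
        using T(3) Q s w by (intro two_coverI[of Q 1 "-s" "-1" "- s"]) (auto simp: is_sign_def)
      have "bent_fork w s (frame Q 0 (-2) w 1)"
        using T clears Q w unfolding bent_fork_def
        by (simp add: clear_frame is_sign_square) (auto simp: frame_def is_sign_def)
      then show "pattern (w * w * 1) s (frame Q 0 (-2) w 1) w 2"
        using w by (simp add: pattern_def bent_def is_sign_square)
    qed (auto simp: w is_sign_square)
  next
    case 3
    show ?thesis
    proof (rule claimableI[of "-1" 1 s Q "-1" "-1" w "-3" 1])
      show "two_cover s Q (-1) (-1 + -1) (-1)"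
        using T(2) km s 3 by (intro two_coverI[of Q "-s" 0 "-k" "- 1 - m"]) auto
      have "\<exists>k m. 2 \<le> k \<and> 0 \<le> m \<and> k + m = s \<and> frame Q (-1) (-1) (-1) 1 (k - 1) (- m)"
        using km 3 minus_diff_commute[of 1 m]
        by - (rule exI[of _ k], rule exI[of _ m], simp add: frame_def)
      then have "bent_side s (frame Q (-1) (-1) (-1) 1)"
        using T clears unfolding bent_side_def
        by (simp add: clear_frame) (simp add: frame_def)
      then show "pattern (w * - 1 * 1) s (frame Q (-1) (-1) (-1) 1) (-3) 1"
        by (simp add: pattern_def bent_def)
    qed auto
  qed
qed

text \<open>Here exactly one of the towers above and below is present at each endpoint, on opposite
  sides. A second tower at distance \<open>s\<close> from \<open>(0, 0)\<close> must lie to the left of it. If it is below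
  the row of the hole, it covers the edge below the hole together with \<open>(1, -s)\<close>; if it is above
  that row, it covers a bent edge together with \<open>(0, s)\<close>. The same holds at \<open>(1, 0)\<close> by symmetry, so
  that only the towers \<open>(-s, 0)\<close> and \<open>(1 + s, 0)\<close> remain.\<close>

lemma claim_opposite:
  assumes s: "s \<ge> 2" and cov: "covering s Q" and h: "hole s Q 0 1 0"
    and T: "Q 0 s" "Q 1 (-s)" and nT: "\<not> Q 0 (-s)" "\<not> Q 1 s"
    and w: "is_sign w"
  shows "claimable w s Q 1 0"
proof (rule ccontr)
  assume neg: "\<not> claimable w s Q 1 0"
  \<comment> \<open>The half turn about the midpoint of the hole swaps the roles of its endpoints.\<close>
  define R where "R = frame Q 1 0 (-1) (-1)"
  have hR: "hole s R 0 1 0"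
    unfolding R_def using h by (rule hole_rotate)
  have R: "R i j = Q (1 - i) (- j)" for i j by (simp add: R_def frame_def)
  have clR: "claimable w s R 1 0 \<Longrightarrow> claimable w s Q 1 0"
    unfolding R_def by (rule claimable_rotate)
  define M where "M = frame Q 0 0 1 (-1)"
  have hM: "hole s M 0 1 0"
    unfolding M_def using h by (rule hole_mirror)
  have M: "M i j = Q i (- j)" for i j by (simp add: M_def frame_def)
  have clM: "claimable (-w) s M 1 0 \<Longrightarrow> claimable w s Q 1 0"
    unfolding M_def by (rule claimable_mirror)
  have left: "i < 0" if "Q i j" "(i, j) \<noteq> (0, s)" "\<bar>i\<bar> + \<bar>j\<bar> = s" for i j
  proof -
    have "i \<le> 0" using holeD(3)[OF h that(1,3)] .
    moreover have "i \<noteq> 0"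
    proof
      assume "i = 0"
      then have "j = s \<or> j = -s" using that(3) by auto
      with \<open>i = 0\<close> that nT show False by auto
    qed
    ultimately show ?thesis by simp
  qed
  have right: "i > 1" if "Q i j" "(i, j) \<noteq> (1, -s)" "\<bar>1 - i\<bar> + \<bar>j\<bar> = s" for i j
  proof -
    have "i \<ge> 1" using holeD(4)[OF h that(1,3)] .
    moreover have "i \<noteq> 1"
    proof
      assume "i = 1"
      then have "j = s \<or> j = -s" using that(3) by auto
      with \<open>i = 1\<close> that nT show False by auto
    qed
    ultimately show ?thesis by simp
  qed
  obtain i j where ij: "Q i j" "(i, j) \<noteq> (0, s)" "\<bar>i\<bar> + \<bar>j\<bar> = s"
    using two_at[OF cov hole_clear(1)[OF h], of "(0, s)"] by auto
  obtain i' j' where ij': "Q i' j'" "(i', j') \<noteq> (1, -s)" "\<bar>1 - i'\<bar> + \<bar>j'\<bar> = s"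
    using two_at[OF cov hole_clear(2)[OF h], of "(1, -s)"] by auto
  have i: "i < 0" and i': "i' > 1" using left[OF ij] right[OF ij'] .
  have "j \<ge> 0"
  proof (rule ccontr)
    assume "\<not> j \<ge> 0"
    have "claimable (- w) s M 1 0"
    proof (rule claim_parallel[OF s hM])
      show "M 0 s \<or> M 1 s" using T by (simp add: M)
      show "two_cover s M 0 1 1"
        using ij T \<open>\<not> j \<ge> 0\<close> i s by (intro two_coverI[of M i "-j" 1 s]) (auto simp: M)
      show "\<not> clear s M 0 1"
        using ij T \<open>\<not> j \<ge> 0\<close> i s by (intro not_clearI[of M i "-j"]) (auto simp: M)
      show "\<not> clear s M 1 1"
        using ij T \<open>\<not> j \<ge> 0\<close> i s by (intro not_clearI[of M 1 s]) (auto simp: M)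
    qed
    with clM neg show False by blast
  qed
  have "j' \<le> 0"
  proof (rule ccontr)
    assume "\<not> j' \<le> 0"
    have "claimable w s Q 1 0"
    proof (rule claim_parallel[OF s h])
      show "Q 0 s \<or> Q 1 s" using T by simp
      show "two_cover s Q 0 1 1"
        using ij' T \<open>\<not> j' \<le> 0\<close> i' s by (intro two_coverI[of Q i' j' 0 s]) auto
      show "\<not> clear s Q 0 1"
        using T s by (intro not_clearI[of Q 0 s]) auto
      show "\<not> clear s Q 1 1"
        using ij' T \<open>\<not> j' \<le> 0\<close> i' s by (intro not_clearI[of Q i' j']) auto
    qed
    with neg show False by blast
  qed
  have j'0: "j' = 0"
  proof (rule ccontr)
    assume "j' \<noteq> 0"
    then have "claimable w s Q 1 0"
      using ij' i' \<open>j' \<le> 0\<close> s T h by (intro claim_bent_pair[of s Q "i' - 1"]) (auto simp: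
          algebra_simps)
    with neg show False by blast
  qed
  have j0: "j = 0"
  proof (rule ccontr)
    assume "j \<noteq> 0"
    then have "claimable w s R 1 0"
      using ij i \<open>j \<ge> 0\<close> s T hR by (intro claim_bent_pair[of s R "- i"]) (auto simp: R)
    with neg clR show False by blast
  qed
  have "claimable w s Q 1 0"
  proof (rule claim_corners[OF s cov h _ _ _ _ _ w])
    show "Q 0 s" "Q 1 (-s)" by fact+
    have eq: "i = -s" "i' = 1 + s" using i i' ij ij' j0 j'0 by auto
    show "Q (-s) 0" using ij j0 eq by simp
    show "(k, l) = (0, s) \<or> (k, l) = (-s, 0)" if "Q k l" "\<bar>k\<bar> + \<bar>l\<bar> = s" for k l
    proof (rule ccontr)
      assume *: "\<not> ?thesis"
      then have "k < 0" using left that by blast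
      then have "claimable w s Q 1 0"
        using * that ij i eq j0 by (intro claim_straight[OF h, of k l i j]) auto
      with neg show False by blast
    qed
    show "(k, l) = (1, -s) \<or> (k, l) = (1 + s, 0)" if "Q k l" "\<bar>1 - k\<bar> + \<bar>l\<bar> = s" for k l
    proof (rule ccontr)
      assume *: "\<not> ?thesis"
      then have "k > 1" using right that by blast
      then have "claimable w s R 1 0"
        using * that ij' i' eq j'0 by (intro claim_straight[OF hR, of "1 - k" "-l" "1 - i'"
            "-j'"]) (auto simp: R)
      with neg clR show False by blast
    qed
  qed
  with neg show False by blast
qed

text \<open>If neither straight claim is possible, then each endpoint has a tower at distance \<open>s\<close> straight
  above or straight below it. Two of them on the same side cover a parallel edge.\<close>

lemma claimable_hole_0:
  assumes s: "s \<ge> 2" and cov: "covering s Q" and h: "hole s Q 0 1 0" and w: "is_sign w"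
  shows "claimable w s Q 1 0"
proof (rule ccontr)
  assume neg: "\<not> claimable w s Q 1 0"
  define R where "R = frame Q 1 0 (-1) (-1)"
  have hR: "hole s R 0 1 0"
    unfolding R_def using h by (rule hole_rotate)
  have R: "R i j = Q (1 - i) (- j)" for i j by (simp add: R_def frame_def)
  have clR: "claimable w s R 1 0 \<Longrightarrow> claimable w s Q 1 0"
    unfolding R_def by (rule claimable_rotate)
  define M where "M = frame Q 0 0 1 (-1)"
  have hM: "hole s M 0 1 0"
    unfolding M_def using h by (rule hole_mirror)
  have M: "M i j = Q i (- j)" for i j by (simp add: M_def frame_def)
  have clM: "claimable (-w) s M 1 0 \<Longrightarrow> claimable w s Q 1 0"
    unfolding M_def by (rule claimable_mirror)
  have covM: "covering s M" unfolding M_def by (rule covering_frame) (simp_all add: cov)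
  have a: "Q 0 s \<or> Q 0 (-s)"
  proof (rule ccontr)
    assume n: "\<not> ?thesis"
    have lt: "i < 0" if "Q i j" "\<bar>i\<bar> + \<bar>j\<bar> = s" for i j
      using holeD(3)[OF h that] that n by (cases "i = 0") (auto simp: abs_if split: if_splits)
    obtain i j where ij: "Q i j" "(i, j) \<noteq> (0, 0)" "\<bar>i\<bar> + \<bar>j\<bar> = s"
      using two_at[OF cov hole_clear(1)[OF h], of "(0, 0)"] by auto
    obtain i' j' where ij': "Q i' j'" "(i', j') \<noteq> (i, j)" "\<bar>i'\<bar> + \<bar>j'\<bar> = s"
      using two_at[OF cov hole_clear(1)[OF h], of "(i, j)"] by auto
    have "claimable w s Q 1 0"
      using ij ij' lt by (intro claim_straight[OF h, of i j i' j']) auto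
    with neg show False by blast
  qed
  have b: "Q 1 s \<or> Q 1 (-s)"
  proof (rule ccontr)
    assume n: "\<not> ?thesis"
    have gt: "i > 1" if "Q i j" "\<bar>1 - i\<bar> + \<bar>j\<bar> = s" for i j
      using holeD(4)[OF h that] that n by (cases "i = 1") (auto simp: abs_if split: if_splits)
    obtain i j where ij: "Q i j" "(i, j) \<noteq> (0, 0)" "\<bar>1 - i\<bar> + \<bar>j\<bar> = s"
      using two_at[OF cov hole_clear(2)[OF h], of "(0, 0)"] by auto
    obtain i' j' where ij': "Q i' j'" "(i', j') \<noteq> (i, j)" "\<bar>1 - i'\<bar> + \<bar>j'\<bar> = s"
      using two_at[OF cov hole_clear(2)[OF h], of "(i, j)"] by auto
    have "claimable w s R 1 0"
      using ij ij' gt by (intro claim_straight[OF hR, of "1 - i" "-j" "1 - i'"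
          "-j'"]) (auto simp: R)
    with neg clR show False by blast
  qed
  have par: "claimable w s P 1 0" if "hole s P 0 1 0" "P 0 s" "P 1 s" for P w
  proof (rule claim_parallel[OF s that(1)])
    show "P 0 s \<or> P 1 s" using that by simp
    show "two_cover s P 0 1 1"
      using that s by (intro two_coverI[of P 0 s 1 s]) auto
    show "\<not> clear s P 0 1" "\<not> clear s P 1 1"
      using not_clearI[of P 0 s 0 1 s] not_clearI[of P 1 s 1 1 s] that s by auto
  qed
  have c: "\<not> (Q 0 s \<and> Q 1 s)" using par[OF h] neg by blast
  have d: "\<not> (Q 0 (-s) \<and> Q 1 (-s))"
  proof
    assume "Q 0 (-s) \<and> Q 1 (-s)"
    then have "claimable (-w) s M 1 0" by (intro par[OF hM]) (auto simp: M)
    with neg clM show False by blast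
  qed
  from a b c d consider "Q 0 s" "Q 1 (-s)" "\<not> Q 0 (-s)" "\<not> Q 1 s"
    | "Q 0 (-s)" "Q 1 s" "\<not> Q 0 s" "\<not> Q 1 (-s)" by blast
  then show False
  proof cases
    case 1
    with claim_opposite[OF s cov h] w neg show False by blast
  next
    case 2
    have "claimable (-w) s M 1 0"
      using claim_opposite[OF s covM hM, of "-w"] 2 w by (auto simp: M is_sign_def)
    with neg clM show False by blast
  qed
qed

lemma claimable_hole:
  assumes s: "s \<ge> 2" and cov: "covering s Q" and h: "hole s Q x (x + 1) y" and w: "is_sign w"
  shows "claimable w s Q (2 * x + 1) y"
proof -
  have "claimable w s (frame Q x y 1 1) 1 0"
    using s w covering_frame[OF _ _ cov] hole_frame[of 1 1 s Q x 0 1 y 0] h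
    by (intro claimable_hole_0) auto
  then show ?thesis by (rule claimable_frame[rotated 2]) auto
qed

section \<open>Counting edges\<close>

text \<open>The horizontal edges that the tower \<open>T\<close> covers; an edge is identified with its left endpoint.\<close>

definition edges_covered :: "nat \<Rightarrow> vertex \<Rightarrow> vertex set" where
  "edges_covered s T = {(x, y).
     \<bar>x - fst T\<bar> + \<bar>y - snd T\<bar> \<le> int s \<and> \<bar>x + 1 - fst T\<bar> + \<bar>y - snd T\<bar> \<le> int s}"

lemma sum_diamond_rows: "(\<Sum>y\<in>{- int m..int m}. 2 * (int m + 1 - \<bar>y\<bar>)) = 2 * (int m + 1)\<^sup>2"
proof (induction m)
  case (Suc m)
  have "{- int (Suc m)..int (Suc m)} =
      insert (- int (Suc m)) (insert (int (Suc m)) {- int m..int m})"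
    by auto
  then have "(\<Sum>y\<in>{- int (Suc m)..int (Suc m)}. 2 * (int (Suc m) + 1 - \<bar>y\<bar>))
      = 4 + (\<Sum>y\<in>{- int m..int m}. 2 * (int m + 1 - \<bar>y\<bar>) + 2)"
    by (simp add: algebra_simps)
  also have "\<dots> = 4 + 2 * (int m + 1)\<^sup>2 + 2 * (2 * int m + 1)"
    unfolding sum.distrib Suc.IH by simp
  finally show ?case by (simp add: power2_eq_square algebra_simps)
qed simp

lemma card_edges_covered:
  assumes "s > 0"
  shows "finite (edges_covered s T)" "card (edges_covered s T) = 2 * s\<^sup>2"
proof -
  obtain m where m: "s = Suc m" using assms by (cases s) auto
  obtain a b where T: "T = (a, b)" by (cases T)
  define S where "S = (SIGMA y:{- int m..int m}. {- (int m + 1 - \<bar>y\<bar>)..<int m + 1 - \<bar>y\<bar>})"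
  have img: "edges_covered s T = (\<lambda>(y, x). (a + x, b + y)) ` S"
  proof (intro equalityI subsetI)
    fix p assume "p \<in> edges_covered s T"
    then have "(snd p - b, fst p - a) \<in> S"
      unfolding edges_covered_def S_def T m by (auto split: prod.splits)
    then show "p \<in> (\<lambda>(y, x). (a + x, b + y)) ` S"
      by (intro image_eqI[of _ _ "(snd p - b, fst p - a)"]) auto
  next
    fix p assume "p \<in> (\<lambda>(y, x). (a + x, b + y)) ` S"
    then show "p \<in> edges_covered s T"
      unfolding edges_covered_def S_def T m by auto
  qed
  have inj: "inj_on (\<lambda>(y, x). (a + x, b + y)) S"
    by (auto simp: inj_on_def)
  have fin: "finite S" unfolding S_def by (intro finite_SigmaI) auto
  show "finite (edges_covered s T)" unfolding img using fin by simp
  have "int (card S) = (\<Sum>y\<in>{- int m..int m}. int (nat (2 * (int m + 1 - \<bar>y\<bar>))))"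
    unfolding S_def by (subst card_SigmaI) auto
  also have "\<dots> = (\<Sum>y\<in>{- int m..int m}. 2 * (int m + 1 - \<bar>y\<bar>))"
    by (intro sum.cong) auto
  also have "\<dots> = int (2 * s\<^sup>2)"
    unfolding sum_diamond_rows m by simp
  finally have "card S = 2 * s\<^sup>2" by linarith
  then show "card (edges_covered s T) = 2 * s\<^sup>2"
    unfolding img by (simp add: card_image inj)
qed

lemma card_grid_square: "card (grid_square n) = (2 * n + 1)\<^sup>2"
proof -
  have "nat (int n - - int n + 1) = 2 * n + 1" by linarith
  then show ?thesis by (simp add: grid_square_def power2_eq_square)
qed

lemma finite_grid_square [simp]: "finite (grid_square n)"
  by (simp add: grid_square_def)

abbreviation towers :: "vertex set \<Rightarrow> int \<Rightarrow> int \<Rightarrow> bool" where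
  "towers TT \<equiv> (\<lambda>i j. (i, j) \<in> TT)"

lemma finite_covering_towers: "finite {T \<in> TT. p \<in> edges_covered s T}"
proof (rule finite_subset)
  show "{T \<in> TT. p \<in> edges_covered s T} \<subseteq>
      {fst p - int s..fst p + int s} \<times> {snd p - int s..snd p + int s}"
    unfolding edges_covered_def by auto
qed simp

lemma double_count:
  assumes "s > 0"
  shows "(\<Sum>p\<in>grid_square n. card {T \<in> TT. p \<in> edges_covered s T}) \<le> 2 * s\<^sup>2
      * card (TT \<inter> grid_square (n + s))"
proof -
  have "(\<Sum>p\<in>grid_square n. card {T \<in> TT. p \<in> edges_covered s T})
      = card (SIGMA p:grid_square n. {T \<in> TT. p \<in> edges_covered s T})"
    using finite_covering_towers by (subst card_SigmaI) auto
  also have "\<dots> \<le> card (SIGMA T:TT \<inter> grid_square (n + s). edges_covered s T)"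
  proof (rule card_inj_on_le)
    show "inj_on prod.swap (SIGMA p:grid_square n. {T \<in> TT. p \<in> edges_covered s T})"
      by (auto simp: inj_on_def)
    show "prod.swap ` (SIGMA p:grid_square n. {T \<in> TT. p \<in> edges_covered s T})
        \<subseteq> (SIGMA T:TT \<inter> grid_square (n + s). edges_covered s T)"
      by (auto simp: edges_covered_def grid_square_def)
    show "finite (SIGMA T:TT \<inter> grid_square (n + s). edges_covered s T)"
      using card_edges_covered(1)[OF assms] by (intro finite_SigmaI) auto
  qed
  also have "\<dots> = 2 * s\<^sup>2 * card (TT \<inter> grid_square (n + s))"
    using card_edges_covered[OF assms] by (subst card_SigmaI) auto
  finally show ?thesis .
qed

lemma claims_near:
  assumes "claims w s Q (2 * x + 1) y (2 * x' + 1) y'"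
  shows "\<bar>x - x'\<bar> \<le> 2" "\<bar>y - y'\<bar> \<le> 2" "two_cover s Q x' (x' + 1) y'"
proof -
  obtain a e n c d where *: "is_sign e" "is_sign n" "2 * x' + 1 = 2 * a + e"
      "2 * x + 1 = 2 * a + e * c" "y = y' + n * d"
     "two_cover s Q a (a + e) y'" "pattern (w * e * n) s (frame Q a y' e n) c d"
    using assms unfolding claims_def by blast
  have cd: "- 3 \<le> c \<and> c \<le> 1" "0 \<le> d \<and> d \<le> 2"
    using *(7) unfolding pattern_def bent_def is_sign_def by auto
  from *(1) have "x' = a \<and> e = 1 \<or> x' = a - 1 \<and> e = -1"
    using *(3) by (auto simp: is_sign_def)
  then show "two_cover s Q x' (x' + 1) y'" "\<bar>x - x'\<bar> \<le> 2"
    using *(4,6) cd two_cover_sym by auto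
  show "\<bar>y - y'\<bar> \<le> 2"
    using *(2,5) cd by (auto simp: is_sign_def)
qed

text \<open>Claims inject the holes of a square into the edges covered twice of a slightly larger one,
  so the covers outnumber the edges of the smaller square.\<close>

lemma covering_lower_bound:
  assumes s: "s \<ge> 2" and cov: "covering (int s) (towers TT)"
  shows "(2 * n + 1)\<^sup>2 \<le> 2 * s\<^sup>2 * card (TT \<inter> grid_square (n + 2 + s))"
proof -
  define holes where "holes = {(x, y). hole (int s) (towers TT) x (x + 1) y}"
  define doubles where "doubles = {(x, y). two_cover (int s) (towers TT) x (x + 1) y}"
  define V where "V = grid_square n"
  define W where "W = grid_square (n + 2)"
  define f where "f = (\<lambda>(x, y). SOME p. claims 1 (int s) (towers TT) (2 * x + 1) y (2 * fst p
      + 1) (snd p))"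
  have f: "claims 1 (int s) (towers TT) (2 * x + 1) y (2 * fst (f (x, y)) + 1) (snd (f (x, y)))"
    if "(x, y) \<in> holes" for x y
  proof -
    have "claimable 1 (int s) (towers TT) (2 * x + 1) y"
      using that s cov by (intro claimable_hole) (auto simp: holes_def)
    then obtain k z where kz: "claims 1 (int s) (towers TT) (2 * x + 1) y k z"
      unfolding claimable_def by blast
    then have "odd k" unfolding claims_def is_sign_def by auto
    then obtain x' where "k = 2 * x' + 1" by (elim oddE)
    with kz have "claims 1 (int s) (towers TT) (2 * x + 1) y (2 * fst (x', z) + 1) (snd (x', z))"
      by simp
    then show ?thesis unfolding f_def prod.case by (rule someI)
  qed
  have "card (holes \<inter> V) \<le> card (doubles \<inter> W)"
  proof (rule card_inj_on_le[of f])
    show "inj_on f (holes \<inter> V)"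
    proof (rule inj_onI, clarify)
      fix x y x' y' assume h: "(x, y) \<in> holes" "(x', y') \<in> holes" "f (x, y) = f (x', y')"
      have "2 * x + 1 = 2 * x' + 1 \<and> y = y'"
        using claims_inj[OF _ _ f[OF h(1)]] f[OF h(2)] h(3) s by simp
      then show "x = x' \<and> y = y'" by simp
    qed
    show "f ` (holes \<inter> V) \<subseteq> doubles \<inter> W"
    proof (rule image_subsetI)
      fix p assume "p \<in> holes \<inter> V"
      then obtain x y where p: "p = (x, y)" and h: "(x, y) \<in> holes" "(x, y) \<in> V"
        by (cases p) auto
      obtain x' y' where xy: "f (x, y) = (x', y')" by (cases "f (x, y)")
      have "claims 1 (int s) (towers TT) (2 * x + 1) y (2 * x' + 1) y'"
        using f[OF h(1)] xy by simp
      from claims_near[OF this] h(2) show "f p \<in> doubles \<inter> W"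
        unfolding p xy doubles_def V_def W_def grid_square_def by auto
    qed
    show "finite (doubles \<inter> W)" by (simp add: W_def)
  qed
  moreover have "card (holes \<inter> W) \<le> card (holes \<inter> V) + card (W - V)"
  proof -
    have "card (holes \<inter> W) \<le> card ((holes \<inter> V) \<union> (W - V))"
      by (rule card_mono) (auto simp: V_def W_def)
    also have "\<dots> \<le> card (holes \<inter> V) + card (W - V)" by (rule card_Un_le)
    finally show ?thesis .
  qed
  moreover have "card (W - V) + card V = card W"
  proof -
    have "V \<subseteq> W" by (auto simp: V_def W_def grid_square_def)
    then show ?thesis
      by (metis V_def W_def add.commute card_Diff_subset card_mono finite_grid_square
          le_add_diff_inverse)
  qed
  moreover have "card W + card (doubles \<inter> W) \<le>
      (\<Sum>p\<in>W. card {T \<in> TT. p \<in> edges_covered s T}) + card (holes \<inter> W)"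
  proof -
    have at_edge: "1 + of_bool (p \<in> doubles) \<le> card {T \<in> TT. p \<in> edges_covered s T}
        + of_bool (p \<in> holes)" for p
    proof -
      obtain x y where p: "p = (x, y)" by (cases p)
      show ?thesis
      proof (cases "p \<in> doubles")
        case True
        then obtain T T' where "T \<in> TT" "T' \<in> TT" "T \<noteq> T'" "p \<in> edges_covered s T"
            "p \<in> edges_covered s T'"
          unfolding doubles_def p two_cover_def edges_covered_def by auto
        then have "card {T, T'} \<le> card {T \<in> TT. p \<in> edges_covered s T}"
          by (intro card_mono finite_covering_towers) auto
        with \<open>T \<noteq> T'\<close> True show ?thesis by simp
      next
        case False
        show ?thesis
        proof (cases "p \<in> holes")
          case True with False show ?thesis by simp
        next
          case nh: False
          then have "{T \<in> TT. p \<in> edges_covered s T} \<noteq> {}"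
            unfolding holes_def p hole_def edges_covered_def by auto
          then have "card {T \<in> TT. p \<in> edges_covered s T} > 0"
            using finite_covering_towers by (simp add: card_gt_0_iff)
          with False nh show ?thesis by simp
        qed
      qed
    qed
    have c: "(\<Sum>p\<in>W. of_bool (p \<in> A)) = card (A \<inter> W)" for A :: "vertex set"
      by (simp add: W_def sum_of_bool_eq Int_commute Int_def conj_commute)
    have "(\<Sum>p\<in>W. 1 + of_bool (p \<in> doubles)) \<le>
        (\<Sum>p\<in>W. card {T \<in> TT. p \<in> edges_covered s T} + of_bool (p \<in> holes))"
      by (intro sum_mono at_edge)
    then show ?thesis by (simp only: sum.distrib c card_eq_sum[symmetric])
  qed
  moreover have "(\<Sum>p\<in>W. card {T \<in> TT. p \<in> edges_covered s T}) \<le> 2 * s\<^sup>2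
      * card (TT \<inter> grid_square (n + 2 + s))"
    unfolding W_def using s by (intro double_count) simp
  ultimately have "card V \<le> 2 * s\<^sup>2 * card (TT \<inter> grid_square (n + 2 + s))" by linarith
  then show ?thesis by (simp add: V_def card_grid_square)
qed

section \<open>Densities\<close>

lemma broadcast_iff_covering:
  assumes "t > 0"
  shows "broadcast t 2 TT \<longleftrightarrow> covering (int t - 1) (towers TT)"
proof -
  define N where "N v = {T \<in> TT. grid_dist v T < t}" for v
  have fin: "finite (N v)" for v
    by (rule finite_subset[OF _ finite_grid_ball[of v t]]) (auto simp: N_def)
  have sig: "total_signal t 2 TT v = (\<Sum>T\<in>N v. tower_signal t 2 v T)" for v
    by (simp add: total_signal_finite N_def)
  have pos: "tower_signal t 2 v T \<ge> 1" if "T \<in> N v" for v T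
    using that by (simp add: N_def tower_signal_def)
  have "total_signal t 2 TT (x, y) \<ge> 2 \<longleftrightarrow> (clear (int t - 1) (towers TT) x y \<longrightarrow>
     (\<exists>i j i' j'. (i, j) \<in> TT \<and> (i', j') \<in> TT \<and> (i, j) \<noteq> (i', j') \<and>
        \<bar>x - i\<bar> + \<bar>y - j\<bar> = int t - 1 \<and> \<bar>x - i'\<bar> + \<bar>y - j'\<bar>
            = int t - 1))" (is "_ \<longleftrightarrow> (?C \<longrightarrow> ?E)") for x y
  proof (cases ?C)
    case False
    then obtain i j where ij: "(i, j) \<in> TT" "\<bar>x - i\<bar> + \<bar>y - j\<bar> < int t - 1"
      unfolding clear_def by (auto simp: not_le)
    then have "int (grid_dist (x, y) (i, j)) < int t - 1"
      by (simp add: grid_dist_eq)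
    with ij(1) have "(i, j) \<in> N (x, y)" "tower_signal t 2 (x, y) (i, j) = 2"
      by (auto simp: N_def tower_signal_def)
    then have "2 \<le> (\<Sum>T\<in>N (x, y). tower_signal t 2 (x, y) T)"
      using member_le_sum[of "(i, j)" "N (x, y)" "tower_signal t 2 (x, y)"] pos[of _ "(x, y)"] fin
      by (force intro: order_trans[of 0 1])
    with False show ?thesis by (simp add: sig)
  next
    case C: True
    have at: "\<bar>x - i\<bar> + \<bar>y - j\<bar> = int t - 1 \<and> (i, j) \<in> TT \<longleftrightarrow> (i, j) \<in> N (x, y)" for i j
    proof -
      have "grid_dist (x, y) (i, j) < t \<longleftrightarrow> \<bar>x - i\<bar> + \<bar>y - j\<bar> < int t"
        using grid_dist_eq[of x y i j] by linarith
      then show ?thesis using clearD[OF C, of i j] assms by (auto simp: N_def)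
    qed
    have "tower_signal t 2 (x, y) T = 1" if "T \<in> N (x, y)" for T
      using that at[of "fst T" "snd T"] by (cases T) (simp add: tower_signal_def grid_dist_eq)
    then have "total_signal t 2 TT (x, y) = int (card (N (x, y)))"
      by (simp add: sig)
    also have "\<dots> \<ge> 2 \<longleftrightarrow> (\<exists>T T'. T \<in> N (x, y) \<and> T' \<in> N (x, y) \<and> T \<noteq> T')"
    proof -
      have "2 \<le> int (card (N (x, y))) \<longleftrightarrow> \<not> card (N (x, y)) \<le> Suc 0" by linarith
      then show ?thesis using card_le_Suc0_iff_eq[OF fin[of "(x, y)"]] by blast
    qed
    also have "\<dots> \<longleftrightarrow> ?E" using at by (metis surj_pair)
    finally show ?thesis using C by simp
  qed
  then show ?thesis unfolding broadcast_def covering_def by auto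
qed

lemma square_ratio_limit:
  assumes "s > 0"
  shows "(\<lambda>n. (2 * (real n + a) + 1)\<^sup>2 / (2 * (real s)\<^sup>2 * (2 * (real n + b) + 1)\<^sup>2)) \<longlonglongrightarrow>
      1 / (2 * (real s)\<^sup>2)"
proof -
  have "(\<lambda>n. (2 * (real n + a) + 1)\<^sup>2 / (2 * (real n + b) + 1)\<^sup>2) \<longlonglongrightarrow> 1"
    by real_asymp
  from tendsto_divide[OF this tendsto_const[of "2 * (real s)\<^sup>2"]] assms show ?thesis
    by (simp add: mult_ac)
qed

lemma density_lower_bound:
  assumes s: "s \<ge> 2" and cov: "covering (int s) (towers TT)" and d: "has_broadcast_density TT d"
  shows "1 / (2 * (real s)\<^sup>2) \<le> d"
proof -
  define c where "c = 2 + s"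
  have "(\<lambda>n. real (card (TT \<inter> grid_square (n + c))) / real (card (grid_square (n + c)))) \<longlonglongrightarrow> d"
    using d unfolding has_broadcast_density_def by (rule LIMSEQ_ignore_initial_segment)
  moreover have "(\<lambda>n. (2 * (real n + 0) + 1)\<^sup>2 / (2 * (real s)\<^sup>2 * (2 * (real n + real c) + 1)\<^sup>2))
      \<longlonglongrightarrow> 1 / (2 * (real s)\<^sup>2)"
    using s by (intro square_ratio_limit) simp
  moreover have "(2 * (real n + 0) + 1)\<^sup>2 / (2 * (real s)\<^sup>2 * (2 * (real n + real c) + 1)\<^sup>2)
      \<le> real (card (TT \<inter> grid_square (n + c))) / real (card (grid_square (n + c)))" for n
  proof -
    have "real ((2 * n + 1)\<^sup>2) \<le> real (2 * s\<^sup>2 * card (TT \<inter> grid_square (n + c)))"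
      using covering_lower_bound[OF s cov, of n] by (simp only: of_nat_le_iff c_def add.assoc)
    then show ?thesis
      using s by (simp add: card_grid_square divide_simps) (simp add: algebra_simps)
  qed
  ultimately show ?thesis
    by (intro LIMSEQ_le[of _ "1 / (2 * (real s)\<^sup>2)" _ d]) auto
qed

text \<open>In the coordinates \<open>x + y\<close> and \<open>x - y\<close>, the diamonds of radius \<open>s\<close> around these points are the
  squares of the square tiling with side \<open>2 * s\<close>.\<close>

definition diamond_lattice :: "nat \<Rightarrow> vertex set" where
  "diamond_lattice s = {(i, j). 2 * int s dvd i + j \<and> 2 * int s dvd i - j}"

lemma lattice_covering:
  assumes "s > 0"
  shows "covering (int s) (towers (diamond_lattice s))"
  unfolding covering_def
proof (intro allI impI)
  fix x y assume C: "clear (int s) (towers (diamond_lattice s)) x y"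
  \<comment> \<open>The lattice point with coordinate sum \<open>2 * s * a\<close> and coordinate difference \<open>2 * s * b\<close>.\<close>
  define P where "P a b = (int s * (a + b), int s * (a - b))" for a b
  have P: "P a b \<in> diamond_lattice s" for a b
    by (auto simp: P_def diamond_lattice_def algebra_simps)
  have near: "\<exists>a. - int s \<le> u - 2 * int s * a \<and> u - 2 * int s * a < int s" for u
  proof
    have "u + int s = 2 * int s * ((u + int s) div (2 * int s)) + (u + int s) mod (2 * int s)"
      by simp
    moreover have "0 \<le> (u + int s) mod (2 * int s)" "(u + int s) mod (2 * int s) < 2 * int s"
      using assms by simp_all
    ultimately show "- int s \<le> u - 2 * int s * ((u + int s) div (2 * int s)) \<and>
      u - 2 * int s * ((u + int s) div (2 * int s)) < int s" by linarith
  qed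
  obtain a where a: "- int s \<le> x + y - 2 * int s * a" "x + y - 2 * int s * a < int s" using near
    by blast
  obtain b where b: "- int s \<le> x - y - 2 * int s * b" "x - y - 2 * int s * b < int s" using near
    by blast
  have dist: "\<bar>x - fst (P a b)\<bar> + \<bar>y - snd (P a b)\<bar> =
      max \<bar>x + y - 2 * int s * a\<bar> \<bar>x - y - 2 * int s * b\<bar>" for a b
    unfolding P_def by (simp add: algebra_simps)
  have "int s \<le> \<bar>x - fst (P a b)\<bar> + \<bar>y - snd (P a b)\<bar>"
    using clearD[OF C, of "fst (P a b)" "snd (P a b)"] P by simp
  then have D: "\<bar>x - fst (P a b)\<bar> + \<bar>y - snd (P a b)\<bar> = int s"
    and "x + y - 2 * int s * a = - int s \<or> x - y - 2 * int s * b = - int s"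
    unfolding dist using a b by auto
  then consider "x + y - 2 * int s * a = - int s" | "x - y - 2 * int s * b = - int s" by blast
  then obtain a' b' where D': "\<bar>x - fst (P a' b')\<bar> + \<bar>y - snd (P a' b')\<bar> = int s" "P a' b' \<noteq> P a b"
  proof cases
    case 1
    then show ?thesis
      using that[of "a - 1" b] a b assms dist[of "a - 1" b] by (auto simp: P_def algebra_simps)
  next
    case 2
    then show ?thesis
      using that[of a "b - 1"] a b assms dist[of a "b - 1"] by (auto simp: P_def algebra_simps)
  qed
  show "\<exists>i j i' j'. (i, j) \<in> diamond_lattice s \<and> (i', j') \<in> diamond_lattice s \<and> (i, j) \<noteq> (i', j') \<and>
     \<bar>x - i\<bar> + \<bar>y - j\<bar> = int s \<and> \<bar>x - i'\<bar> + \<bar>y - j'\<bar> = int s"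
    using P D D' by (metis prod.collapse)
qed

text \<open>No edge is covered by two towers of the lattice.\<close>

lemma lattice_upper_bound:
  assumes s: "s > 0"
  shows "2 * s\<^sup>2 * card (diamond_lattice s \<inter> grid_square n) \<le> (2 * (n + s) + 1)\<^sup>2"
proof -
  have disj: "edges_covered s T \<inter> edges_covered s T' = {}" if T: "T \<in> diamond_lattice s"
      "T' \<in> diamond_lattice s" "T \<noteq> T'" for T T'
  proof (rule ccontr)
    assume "edges_covered s T \<inter> edges_covered s T' \<noteq> {}"
    obtain i j i' j' where ij: "T = (i, j)" "T' = (i', j')" by (cases T, cases T')
    obtain x y where "(x, y) \<in> edges_covered s T" "(x, y) \<in> edges_covered s T'"
      using \<open>edges_covered s T \<inter> edges_covered s T' \<noteq> {}\<close> by auto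
    then have "\<bar>x - i\<bar> + \<bar>y - j\<bar> \<le> int s" "\<bar>x + 1 - i\<bar> + \<bar>y - j\<bar> \<le> int s"
      "\<bar>x - i'\<bar> + \<bar>y - j'\<bar> \<le> int s" "\<bar>x + 1 - i'\<bar> + \<bar>y - j'\<bar> \<le> int s"
      unfolding edges_covered_def ij by auto
    then have lt: "\<bar>i - i'\<bar> + \<bar>j - j'\<bar> < 2 * int s"
      by (cases "i \<le> x"; cases "i' \<le> x") linarith+
    have "2 * int s dvd (i - i') + (j - j')" "2 * int s dvd (i - i') - (j - j')"
      using T(1,2) dvd_diff[of "2 * int s" "i + j" "i' + j'"] dvd_diff[of "2 * int s" "i - j"
          "i' - j'"]
      unfolding ij diamond_lattice_def by (auto simp: algebra_simps)
    moreover have "k = 0" if "2 * int s dvd k" "\<bar>k\<bar> < 2 * int s" for k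
      using dvd_imp_le_int[of k "2 * int s"] that by fastforce
    moreover have "\<bar>(i - i') + (j - j')\<bar> < 2 * int s" "\<bar>(i - i') - (j - j')\<bar> < 2 * int s"
      using lt by linarith+
    ultimately have "(i - i') + (j - j') = 0" "(i - i') - (j - j') = 0"
      by blast+
    then show False using T(3) ij by auto
  qed
  have "2 * s\<^sup>2 * card (diamond_lattice s \<inter> grid_square n)
      = (\<Sum>T\<in>diamond_lattice s \<inter> grid_square n. card (edges_covered s T))"
    using card_edges_covered[OF s] by simp
  also have "\<dots> = card (\<Union>T\<in>diamond_lattice s \<inter> grid_square n. edges_covered s T)"
    using card_edges_covered(1)[OF s] disj by (subst card_UN_disjoint) auto
  also have "\<dots> \<le> card (grid_square (n + s))"
    by (rule card_mono) (auto simp: grid_square_def edges_covered_def)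
  finally show ?thesis by (simp add: card_grid_square)
qed

lemma lattice_density:
  assumes s: "s \<ge> 2"
  shows "has_broadcast_density (diamond_lattice s) (1 / (2 * (real s)\<^sup>2))"
proof -
  define c where "c = 2 + s"
  define q where "q n = real (card (diamond_lattice s \<inter> grid_square n))
      / real (card (grid_square n))" for n
  have cov: "covering (int s) (towers (diamond_lattice s))" using s by (intro lattice_covering) simp
  have "(\<lambda>n. q (n + c)) \<longlonglongrightarrow> 1 / (2 * (real s)\<^sup>2)"
  proof (rule tendsto_sandwich)
    show "(\<lambda>n. (2 * (real n + 0) + 1)\<^sup>2 / (2 * (real s)\<^sup>2 * (2 * (real n + real c) + 1)\<^sup>2)) \<longlonglongrightarrow> 1
        / (2 * (real s)\<^sup>2)"
      using s by (intro square_ratio_limit) simp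
    show "(\<lambda>n. (2 * (real n + (real c + real s)) + 1)\<^sup>2 / (2 * (real s)\<^sup>2 * (2 * (real n + real c)
        + 1)\<^sup>2)) \<longlonglongrightarrow> 1 / (2 * (real s)\<^sup>2)"
      using s by (intro square_ratio_limit) simp
    have "(2 * (real n + 0) + 1)\<^sup>2 / (2 * (real s)\<^sup>2 * (2 * (real n + real c) + 1)\<^sup>2) \<le> q (n
        + c)" for n
    proof -
      have "real ((2 * n + 1)\<^sup>2) \<le> real (2 * s\<^sup>2 * card (diamond_lattice s \<inter> grid_square (n + c)))"
        using covering_lower_bound[OF s cov, of n] by (simp only: of_nat_le_iff c_def add.assoc)
      then show ?thesis
        using s by (simp add: q_def card_grid_square divide_simps) (simp add: algebra_simps)
    qed
    then show "\<forall>\<^sub>F n in sequentially. (2 * (real n + 0) + 1)\<^sup>2 / (2 * (real s)\<^sup>2 * (2 * (real n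
        + real c) + 1)\<^sup>2) \<le> q (n + c)"
      by simp
    have "q (n + c) \<le> (2 * (real n + (real c + real s)) + 1)\<^sup>2 / (2 * (real s)\<^sup>2 * (2 * (real n
        + real c) + 1)\<^sup>2)" for n
    proof -
      have "real (2 * s\<^sup>2 * card (diamond_lattice s \<inter> grid_square (n + c))) \<le> real ((2 * (n + c
          + s) + 1)\<^sup>2)"
        using lattice_upper_bound[of s "n + c"] s by (simp only: of_nat_le_iff)
      then show ?thesis
        using s by (simp add: q_def card_grid_square divide_simps) (simp add: algebra_simps)
    qed
    then show "\<forall>\<^sub>F n in sequentially. q (n + c) \<le> (2 * (real n + (real c + real s)) + 1)\<^sup>2 / (2
        * (real s)\<^sup>2 * (2 * (real n + real c) + 1)\<^sup>2)"
      by simp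
  qed
  then have "q \<longlonglongrightarrow> 1 / (2 * (real s)\<^sup>2)" by (rule LIMSEQ_offset)
  then show ?thesis unfolding has_broadcast_density_def q_def .
qed

theorem theorem2:
  fixes t :: nat
  assumes "t > 2"
  shows "is_optimal_density t 2 (1 / (2 * (real t - 1)\<^sup>2))"
proof -
  define s where "s = t - 1"
  have s: "s \<ge> 2" "real s = real t - 1" "int s = int t - 1"
    using assms by (auto simp: s_def)
  have iff: "broadcast t 2 TT \<longleftrightarrow> covering (int s) (towers TT)" for TT
    using broadcast_iff_covering[of t TT] assms s by simp
  have "broadcast t 2 (diamond_lattice s)"
    using lattice_covering[of s] s(1) by (simp add: iff)
  then show ?thesis
    using lattice_density[OF s(1)] density_lower_bound[OF s(1)]
    unfolding is_optimal_density_def broadcast_densities_def s(2) iff by blast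
qed

end
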